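(* Assume that $N\to\infty$, $n\to\infty$, $p=n/N\to 0$ and $M\to\infty$, $m\to\infty$, $q=m/M\to 0$, and let $a=a_{n,m,N,M}>0$. Put $$A = \frac{a \sqrt{nm}}{ \sqrt{2(n \log(p^{-1})+m \log(q^{-1} ) )} },\quad A_1 = \frac{a \sqrt{m}}{ \sqrt{2}\, (\sqrt{\log(n)}+\sqrt{\log(N-n)}) },\quad A_2 = \frac{a \sqrt{n}}{ \sqrt{2}\, (\sqrt{\log(m)}+\sqrt{\log(M-m)})},$$ and $B_{n,m,N,M}=\min\{A_1,A_2,A\}$. If $$\liminf B_{n,m,N,M} > 1,$$ then the selector $\hat C^\star(Y)=\arg\max_{C\in\mathcal{C}_{nm}}\sum_{(i,j)\in C}Y_{ij}$ is consistent in the minimax sense, that is, $$R_{nm,a}(\hat C^\star)=\sup_{S_{C_0}\in\mathcal{S}_{nm,a}}P_{C_0}(\hat C^\star(Y) \ne C_0)\longrightarrow 0 .$$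
   Context: Model: one observes an $N\times M$ random matrix $Y=\{Y_{ij}\}$, $Y_{ij}=s_{ij}+\xi_{ij}$, $i=1,\dots,N$, $j=1,\dots,M$, where the $\xi_{ij}$ are i.i.d. standard Gaussian $\mathcal{N}(0,1)$ and $s_{ij}\in\mathbb{R}$ are deterministic. $\mathcal{C}_{nm}$ is the collection of all sets $C=A\times B\subset\{1,\dots,N\}\times\{1,\dots,M\}$ with $\mathrm{Card}(A)=n$, $\mathrm{Card}(B)=m$ (here $A,B$ are index sets, unrelated to the real numbers $A$, $B_{n,m,N,M}$ of the claim). For $a>0$, $\mathcal{S}_{nm,a}$ is the set of all real $N\times M$ matrices $S=S_{C}=\{s_{ij}\}$ for which there is $C\in\mathcal{C}_{nm}$ such that $s_{ij}=0$ if $(i,j)\notin C$ and $s_{ij}\ge a$ if $(i,j)\in C$; the set $C$ is determined by $S$ (it is the support of $S$), and $S_C$ denotes such a matrix with support $C$. $P_{C}$ denotes the law of $Y$ when the mean matrix is $S=S_C$; the supremum over $S_{C_0}\in\mathcal{S}_{nm,a}$ runs over all matrices in the class, $C_0$ being the support of the matrix. A selector is a measurable function $\hat C=\hat C(Y)$ with values in $\mathcal{C}_{nm}$; its maximal risk is $R_{nm,a}(\hat C)=\sup_{S_{C_0}\in\mathcal{S}_{nm,a}}P_{C_0}(\hat C(Y)\neq C_0)$. The maximizer defining $\hat C^\star$ is almost surely unique. Asymptotics: $n=n_{NM}$, $m=m_{NM}$ and $a$ depend on $N,M$; all limits, $\liminf$ and $\limsup$ are taken as $N,M\to\infty$. 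*)

theory Defs
  imports "HOL-Probability.Probability"
begin

definition grid :: "nat \<Rightarrow> nat \<Rightarrow> (nat \<times> nat) set" where
  "grid N M = {1..N} \<times> {1..M}"

(* A real N x M matrix is an element of the extensional function space
   grid N M \<rightarrow>\<^sub>E UNIV, which is the underlying set of matrix_space N M. *)
definition matrix_space :: "nat \<Rightarrow> nat \<Rightarrow> (nat \<times> nat \<Rightarrow> real) measure" where
  "matrix_space N M = PiM (grid N M) (\<lambda>_. borel)"

definition submatrices :: "nat \<Rightarrow> nat \<Rightarrow> nat \<Rightarrow> nat \<Rightarrow> (nat \<times> nat) set set" where
  "submatrices N M n m =
     {A \<times> B | A B. A \<subseteq> {1..N} \<and> B \<subseteq> {1..M} \<and> card A = n \<and> card B = m}"

definition mean_class ::
    "nat \<Rightarrow> nat \<Rightarrow> nat \<Rightarrow> nat \<Rightarrow> real \<Rightarrow> (nat \<times> nat \<Rightarrow> real) set" where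
  "mean_class N M n m a =
     {S \<in> grid N M \<rightarrow>\<^sub>E UNIV. \<exists>C \<in> submatrices N M n m.
        \<forall>x \<in> grid N M. (x \<notin> C \<longrightarrow> S x = 0) \<and> (x \<in> C \<longrightarrow> S x \<ge> a)}"

definition matrix_support :: "nat \<Rightarrow> nat \<Rightarrow> (nat \<times> nat \<Rightarrow> real) \<Rightarrow> (nat \<times> nat) set" where
  "matrix_support N M S = {x \<in> grid N M. S x \<noteq> 0}"

definition noise_law :: "nat \<Rightarrow> nat \<Rightarrow> (nat \<times> nat \<Rightarrow> real) measure" where
  "noise_law N M = PiM (grid N M) (\<lambda>_. density lborel std_normal_density)"

definition observation_law ::
    "nat \<Rightarrow> nat \<Rightarrow> (nat \<times> nat \<Rightarrow> real) \<Rightarrow> (nat \<times> nat \<Rightarrow> real) measure" where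
  "observation_law N M S =
     distr (noise_law N M) (matrix_space N M) (\<lambda>\<xi>. \<lambda>x \<in> grid N M. S x + \<xi> x)"

definition selector ::
    "nat \<Rightarrow> nat \<Rightarrow> nat \<Rightarrow> nat \<Rightarrow> ((nat \<times> nat \<Rightarrow> real) \<Rightarrow> (nat \<times> nat) set) \<Rightarrow> bool" where
  "selector N M n m Chat \<longleftrightarrow>
     Chat \<in> matrix_space N M \<rightarrow>\<^sub>M count_space (submatrices N M n m)"

(* The supremum of probabilities is taken in the reals; the class is nonempty as soon as
   n \<le> N and m \<le> M. *)
definition max_risk ::
    "nat \<Rightarrow> nat \<Rightarrow> nat \<Rightarrow> nat \<Rightarrow> real \<Rightarrow> ((nat \<times> nat \<Rightarrow> real) \<Rightarrow> (nat \<times> nat) set) \<Rightarrow> real" where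
  "max_risk N M n m a Chat =
     (SUP S \<in> mean_class N M n m a.
        measure (observation_law N M S)
          {Y \<in> space (observation_law N M S). Chat Y \<noteq> matrix_support N M S})"

(* Ties, an event of probability zero, are broken by arg_max through a choice that depends
   on Y only via the set of maximizers; hence the selector is measurable (see below). *)
definition max_selector ::
    "nat \<Rightarrow> nat \<Rightarrow> nat \<Rightarrow> nat \<Rightarrow> (nat \<times> nat \<Rightarrow> real) \<Rightarrow> (nat \<times> nat) set" where
  "max_selector N M n m Y = arg_max (\<lambda>C. \<Sum>x\<in>C. Y x) (\<lambda>C. C \<in> submatrices N M n m)"

definition bound_A :: "nat \<Rightarrow> nat \<Rightarrow> nat \<Rightarrow> nat \<Rightarrow> real \<Rightarrow> real" where
  "bound_A N M n m a =
     (let p = real n / real N; q = real m / real M in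
      a * sqrt (real n * real m) / sqrt (2 * (real n * ln (inverse p) + real m * ln (inverse q))))"

definition bound_A1 :: "nat \<Rightarrow> nat \<Rightarrow> nat \<Rightarrow> real \<Rightarrow> real" where
  "bound_A1 N n m a =
     a * sqrt (real m) / (sqrt 2 * (sqrt (ln (real n)) + sqrt (ln (real N - real n))))"

definition bound_A2 :: "nat \<Rightarrow> nat \<Rightarrow> nat \<Rightarrow> real \<Rightarrow> real" where
  "bound_A2 M n m a =
     a * sqrt (real n) / (sqrt 2 * (sqrt (ln (real m)) + sqrt (ln (real M - real m))))"

definition bound_B :: "nat \<Rightarrow> nat \<Rightarrow> nat \<Rightarrow> nat \<Rightarrow> real \<Rightarrow> real" where
  "bound_B N M n m a = Min {bound_A1 N n m a, bound_A2 M n m a, bound_A N M n m a}"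

lemma finite_submatrices: "finite (submatrices N M n m)"
proof (rule finite_subset)
  show "submatrices N M n m \<subseteq> Pow (grid N M)"
    by (auto simp: submatrices_def grid_def)
qed (simp add: grid_def)

lemma submatrices_nonempty:
  assumes "n \<le> N" "m \<le> M"
  shows "submatrices N M n m \<noteq> {}"
proof -
  have "{1..n} \<times> {1..m} \<in> submatrices N M n m"
    unfolding submatrices_def mem_Collect_eq
    by (intro exI[of _ "{1..n}"] exI[of _ "{1..m}"]) (use assms in simp)
  then show ?thesis by blast
qed

lemma is_arg_max_max_selector:
  assumes "n \<le> N" "m \<le> M"
  shows "is_arg_max (\<lambda>C. \<Sum>x\<in>C. Y x) (\<lambda>C. C \<in> submatrices N M n m) (max_selector N M n m Y)"
proof -
  let ?F = "submatrices N M n m" and ?f = "\<lambda>C. \<Sum>x\<in>C. Y x :: real"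
  have "Max (?f ` ?F) \<in> ?f ` ?F"
    using finite_submatrices submatrices_nonempty[OF assms] by (intro Max_in) auto
  then obtain C where C: "C \<in> ?F" "?f C = Max (?f ` ?F)" by auto
  have "?f D \<le> ?f C" if "D \<in> ?F" for D
    unfolding C(2) using that finite_submatrices by (intro Max_ge) auto
  with C(1) have "is_arg_max ?f (\<lambda>C. C \<in> ?F) C"
    by (auto simp: is_arg_max_def not_less)
  then show ?thesis
    unfolding max_selector_def arg_max_def by (rule someI)
qed

lemma selector_max_selector:
  assumes "n \<le> N" "m \<le> M"
  shows "selector N M n m (max_selector N M n m)"
proof -
  let ?F = "submatrices N M n m"
  define top where "top C Y \<longleftrightarrow> (\<forall>D\<in>?F. (\<Sum>x\<in>D. Y x) \<le> (\<Sum>x\<in>C. Y x :: real))" for C Y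
  define T where "T Y = {C \<in> ?F. top C Y}" for Y
  have sum_meas: "(\<lambda>Y. \<Sum>x\<in>C. Y x) \<in> borel_measurable (matrix_space N M)" if "C \<in> ?F" for C
  proof (rule borel_measurable_sum)
    fix x assume "x \<in> C"
    with that have "x \<in> grid N M" by (auto simp: submatrices_def grid_def)
    then show "(\<lambda>Y. Y x) \<in> borel_measurable (matrix_space N M)"
      unfolding matrix_space_def by (rule measurable_component_singleton)
  qed
  have T_meas: "T \<in> matrix_space N M \<rightarrow>\<^sub>M count_space (Pow ?F)"
  proof (subst measurable_count_space_eq2)
    show "finite (Pow ?F)" by (simp add: finite_submatrices)
    show "T \<in> space (matrix_space N M) \<rightarrow> Pow ?F \<and>
      (\<forall>U\<in>Pow ?F. T -` {U} \<inter> space (matrix_space N M) \<in> sets (matrix_space N M))"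
    proof (intro conjI ballI)
      show "T \<in> space (matrix_space N M) \<rightarrow> Pow ?F" by (auto simp: T_def)
      fix U assume U: "U \<in> Pow ?F"
      have "T Y = U \<longleftrightarrow> (\<forall>C\<in>?F. C \<in> U \<longleftrightarrow> top C Y)" for Y
        using U unfolding T_def by blast
      then have "T -` {U} \<inter> space (matrix_space N M) =
          {Y \<in> space (matrix_space N M). \<forall>C\<in>?F. C \<in> U \<longleftrightarrow> top C Y}"
        by blast
      also have "\<dots> \<in> sets (matrix_space N M)"
      proof (rule sets.sets_Collect_finite_All[OF _ finite_submatrices])
        fix C assume "C \<in> ?F"
        then have *: "{Y \<in> space (matrix_space N M). top C Y} \<in> sets (matrix_space N M)"
          unfolding top_def
          by (intro sets.sets_Collect_finite_All[OF _ finite_submatrices] borel_measurable_le sum_meas)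
        show "{Y \<in> space (matrix_space N M). C \<in> U \<longleftrightarrow> top C Y} \<in> sets (matrix_space N M)"
          using * sets.sets_Collect_neg[OF *] by (cases "C \<in> U") simp_all
      qed
      finally show "T -` {U} \<inter> space (matrix_space N M) \<in> sets (matrix_space N M)" .
    qed
  qed
  have eq: "max_selector N M n m = (\<lambda>Y. SOME C. C \<in> T Y)"
  proof
    fix Y
    have "is_arg_max (\<lambda>C. \<Sum>x\<in>C. Y x) (\<lambda>C. C \<in> ?F) = (\<lambda>C. C \<in> T Y)"
      by (rule ext) (auto simp only: is_arg_max_def T_def top_def not_less mem_Collect_eq)
    then show "max_selector N M n m Y = (SOME C. C \<in> T Y)"
      unfolding max_selector_def arg_max_def by (rule arg_cong)
  qed
  have "(\<lambda>U. SOME C. C \<in> U) \<in> count_space (Pow ?F) \<rightarrow>\<^sub>M count_space UNIV"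
    unfolding measurable_count_space_eq1 by simp
  from measurable_compose[OF T_meas this]
  have meas: "max_selector N M n m \<in> matrix_space N M \<rightarrow>\<^sub>M count_space UNIV"
    unfolding eq .
  have val: "max_selector N M n m Y \<in> ?F" for Y
    using is_arg_max_max_selector[OF assms] unfolding is_arg_max_def by (rule conjunct1)
  show ?thesis
    unfolding selector_def
  proof (rule measurableI)
    fix U assume "U \<in> sets (count_space ?F)"
    show "max_selector N M n m -` U \<inter> space (matrix_space N M) \<in> sets (matrix_space N M)"
      by (rule measurable_sets[OF meas]) simp
  qed (use val in simp)
qed

end

theory Submission
  imports Defs
begin

text \<open>Fix the true support \<open>A0 \<times> B0\<close> and a competitor \<open>A \<times> B\<close> that misses \<open>k\<close> of its rows and \<open>l\<close> of its
columns. The competitor misses \<open>d = k m + n l - k l\<close> entries, so the true block is ahead by at least \<open>a d\<close> in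
mean, and the competitor wins only if the noise makes up for this. A union bound over the competitors with
the variance \<open>2 d\<close> of the noise difference is not sharp: it treats the noise that is lost on the true
block, which takes few values, like the noise that is gained outside of it, which takes many.
The proof therefore bounds these contributions separately, in two regimes.

If \<open>d\<close> is at least a fixed small fraction of \<open>n m\<close> (\<open>far\<close>), split \<open>a d\<close> into \<open>\<epsilon> a d\<close> for the lost noise and
\<open>(1 - \<epsilon>) a d\<close> for the gained noise. There are only \<open>2\<close> to the power \<open>n + m\<close> possibilities for the former,
which is negligible since \<open>p\<close> and \<open>q\<close> tend to \<open>0\<close>. The gained noise has at most about
\<open>exp (k log (1/p) + l log (1/q))\<close> possibilities, and this is beaten because \<open>d \<ge> k m\<close> and \<open>d \<ge> n l\<close>
turn the condition on \<open>bound_A\<close> into \<open>a\<^sup>2 d / 2 > k log (1/p) + l log (1/q)\<close>, with room to spare.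
Here \<open>p = n / N\<close> and \<open>q = m / M\<close>.

If \<open>k\<close> and \<open>l\<close> are small fractions of \<open>n\<close> and \<open>m\<close>, write \<open>\<alpha>\<close> and \<open>\<beta>\<close> for the differences of the
indicators of \<open>A0\<close> and \<open>A\<close>, and of \<open>B0\<close> and \<open>B\<close>. The indicator of \<open>A0 \<times> B0\<close> minus that of \<open>A \<times> B\<close> is
\<open>\<alpha> 1\<^bsub>B0\<^esub> + 1\<^bsub>A0\<^esub> \<beta> - \<alpha> \<beta>\<close>. The first term exchanges \<open>k\<close> row sums over \<open>B0\<close> for \<open>k\<close> others.
The smallest of \<open>n\<close> such sums is about \<open>- sqrt (2 m log n)\<close> and the largest of the \<open>N - n\<close> others about
\<open>sqrt (2 m log (N - n))\<close>, which is where the sum of square roots in \<open>bound_A1\<close> comes from; likewise for columns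
and \<open>bound_A2\<close>. The last term has variance only \<open>4 k l\<close>, much less than \<open>k m + n l\<close>, and costs an arbitrarily
small fraction of \<open>a (k m + n l)\<close>.

The resulting bad event concerns the noise alone, and its probability has a bound depending only on
\<open>n\<close>, \<open>m\<close> and a lower bound \<open>b > 1\<close> of \<open>bound_B\<close>. This gives uniformity over the mean matrices.\<close>

section \<open>Gaussian linear forms\<close>

abbreviation std_normal :: "real measure" where
  "std_normal \<equiv> density lborel std_normal_density"

lemma prob_space_std_normal: "prob_space std_normal"
  by (rule prob_space_normal_density) simp

lemma gaussian_mgf:
  "(\<integral>\<^sup>+z. ennreal (exp (c * z)) \<partial>std_normal) = ennreal (exp (c\<^sup>2 / 2))"
proof -
  have complete_square: "std_normal_density z * exp (c * z) = exp (c\<^sup>2 / 2) * normal_density c 1 z" for z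
  proof -
    have "- z\<^sup>2 / 2 + c * z = c\<^sup>2 / 2 + - (z - c)\<^sup>2 / 2"
      by (simp add: power2_eq_square field_simps)
    then show ?thesis
      by (simp add: normal_density_def flip: exp_add)
  qed
  have "(\<integral>\<^sup>+z. ennreal (exp (c * z)) \<partial>std_normal)
      = (\<integral>\<^sup>+z. ennreal (std_normal_density z * exp (c * z)) \<partial>lborel)"
    by (subst nn_integral_density) (auto simp: ennreal_mult' normal_density_nonneg)
  also have "\<dots> = (\<integral>\<^sup>+z. ennreal (exp (c\<^sup>2 / 2)) * ennreal (normal_density c 1 z) \<partial>lborel)"
    by (simp only: complete_square) (simp add: ennreal_mult' normal_density_nonneg)
  also have "\<dots> = ennreal (exp (c\<^sup>2 / 2)) * (\<integral>\<^sup>+z. ennreal (normal_density c 1 z) \<partial>lborel)"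
    by (rule nn_integral_cmult) simp
  also have "(\<integral>\<^sup>+z. ennreal (normal_density c 1 z) \<partial>lborel) = 1"
    by (simp add: nn_integral_eq_integral normal_density_nonneg)
  finally show ?thesis by simp
qed

text \<open>Chernoff's bound: the exponential moment factorizes over the coordinates. For \<open>v = 0\<close> the right-hand side is \<open>exp 0 = 1\<close>.\<close>

lemma gaussian_tail:
  fixes w :: "'i \<Rightarrow> real"
  assumes G: "finite G" and t: "0 \<le> t" and v: "(\<Sum>x\<in>G. (w x)\<^sup>2) \<le> v"
  defines "P \<equiv> PiM G (\<lambda>_. std_normal)"
  shows "measure P {\<xi> \<in> space P. t \<le> (\<Sum>x\<in>G. w x * \<xi> x)} \<le> exp (- t\<^sup>2 / (2 * v))"
proof -
  interpret std1: prob_space std_normal by (rule prob_space_std_normal)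
  interpret std: product_sigma_finite "\<lambda>_. std_normal" ..
  interpret P: prob_space P unfolding P_def by (rule prob_space_PiM) (rule prob_space_std_normal)
  show ?thesis
  proof (cases "0 < t \<and> 0 < v")
    case False
    moreover have "0 \<le> v" using v sum_nonneg[of G "\<lambda>x. (w x)\<^sup>2"] by fastforce
    ultimately have "t = 0 \<or> v = 0" using t by linarith
    then show ?thesis by auto
  next
    case True
    \<comment> \<open>This value minimizes the exponent \<open>- l t + l\<^sup>2 v / 2\<close>.\<close>
    define l where "l = t / v"
    have l: "0 < l" using True by (simp add: l_def)
    let ?L = "\<lambda>\<xi>. \<Sum>x\<in>G. w x * \<xi> x"
    have meas: "(\<lambda>\<xi>. ?L \<xi> * indicator (space P) \<xi>) \<in> borel_measurable P"
      unfolding P_def by measurable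
    have "emeasure P {\<xi> \<in> space P. t \<le> ?L \<xi>}
        \<le> ennreal (exp (- l * t)) * (\<integral>\<^sup>+\<xi>. ennreal (exp (l * ?L \<xi>)) * indicator (space P) \<xi> \<partial>P)"
      using l meas by (intro Chernoff_ineq_nn_integral_ge) auto
    also have "(\<integral>\<^sup>+\<xi>. ennreal (exp (l * ?L \<xi>)) * indicator (space P) \<xi> \<partial>P)
        = (\<integral>\<^sup>+\<xi>. (\<Prod>x\<in>G. ennreal (exp (l * w x * \<xi> x))) \<partial>P)"
      using G by (intro nn_integral_cong) (simp add: sum_distrib_left exp_sum prod_ennreal mult.assoc)
    also have "\<dots> = (\<Prod>x\<in>G. ennreal (exp ((l * w x)\<^sup>2 / 2)))"
      unfolding P_def using G by (subst std.product_nn_integral_prod) (simp_all add: gaussian_mgf)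
    also have "\<dots> = ennreal (exp (l\<^sup>2 / 2 * (\<Sum>x\<in>G. (w x)\<^sup>2)))"
      using G by (simp add: prod_ennreal exp_sum[symmetric] sum_distrib_left power_mult_distrib)
    also have "ennreal (exp (- l * t)) * \<dots> = ennreal (exp (- l * t + l\<^sup>2 / 2 * (\<Sum>x\<in>G. (w x)\<^sup>2)))"
      by (simp only: exp_add ennreal_mult' exp_ge_zero)
    also have "\<dots> \<le> ennreal (exp (- l * t + l\<^sup>2 / 2 * v))"
      using v by (intro ennreal_leI) (simp add: mult_left_mono)
    also have "- l * t + l\<^sup>2 / 2 * v = - t\<^sup>2 / (2 * v)"
      using True by (simp add: l_def power2_eq_square field_simps)
    finally show ?thesis
      by (simp add: P.emeasure_eq_measure)
  qed
qed

text \<open>Every bad event below has this shape, with an index set that lists rows, columns or competitors.\<close>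

lemma gaussian_union_bound:
  fixes w :: "'s \<Rightarrow> 'i \<Rightarrow> real"
  assumes G: "finite G" and J: "finite J"
    and t: "\<And>s. s \<in> J \<Longrightarrow> 0 \<le> t s" and v: "\<And>s. s \<in> J \<Longrightarrow> (\<Sum>x\<in>G. (w s x)\<^sup>2) \<le> v s"
  defines "P \<equiv> PiM G (\<lambda>_. std_normal)"
  shows "measure P {\<xi> \<in> space P. \<exists>s\<in>J. t s \<le> (\<Sum>x\<in>G. w s x * \<xi> x)}
      \<le> (\<Sum>s\<in>J. exp (- (t s)\<^sup>2 / (2 * v s)))"
proof -
  interpret P: prob_space P unfolding P_def by (rule prob_space_PiM) (rule prob_space_std_normal)
  have "measure P (\<Union>s\<in>J. {\<xi> \<in> space P. t s \<le> (\<Sum>x\<in>G. w s x * \<xi> x)})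
      \<le> (\<Sum>s\<in>J. measure P {\<xi> \<in> space P. t s \<le> (\<Sum>x\<in>G. w s x * \<xi> x)})"
    using J by (intro P.finite_measure_subadditive_finite) (auto simp: P_def)
  also have "\<dots> \<le> (\<Sum>s\<in>J. exp (- (t s)\<^sup>2 / (2 * v s)))"
    unfolding P_def by (intro sum_mono gaussian_tail G t v)
  also have "(\<Union>s\<in>J. {\<xi> \<in> space P. t s \<le> (\<Sum>x\<in>G. w s x * \<xi> x)})
      = {\<xi> \<in> space P. \<exists>s\<in>J. t s \<le> (\<Sum>x\<in>G. w s x * \<xi> x)}"
    by blast
  finally show ?thesis .
qed

lemma indicator_weights:
  fixes s :: real
  assumes "finite G" "D \<subseteq> G"
  shows "(\<Sum>x\<in>G. (s * indicator D x)\<^sup>2) = s\<^sup>2 * real (card D)"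
    and "(\<Sum>x\<in>G. (s * indicator D x) * f x) = s * sum f D"
proof -
  have "(\<Sum>x\<in>G. (s * indicator D x)\<^sup>2) = (\<Sum>x\<in>D. s\<^sup>2)"
    using assms by (intro sum.mono_neutral_cong_right) auto
  then show "(\<Sum>x\<in>G. (s * indicator D x)\<^sup>2) = s\<^sup>2 * real (card D)" by simp
  have "(\<Sum>x\<in>G. (s * indicator D x) * f x) = (\<Sum>x\<in>D. s * f x)"
    using assms by (intro sum.mono_neutral_cong_right) auto
  then show "(\<Sum>x\<in>G. (s * indicator D x) * f x) = s * sum f D" by (simp only: sum_distrib_left)
qed

text \<open>Each block sum is Gaussian with variance \<open>m\<close>, so each event has probability at most \<open>K\<close> to the power
\<open>- c\<^sup>2\<close>, where \<open>K\<close> is the number of blocks. The blocks may overlap. The sign \<open>\<sigma>\<close> makes the same bound serve for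
lower and upper deviations.\<close>

lemma gaussian_block_max:
  fixes D :: "'s \<Rightarrow> 'i set" and \<sigma> :: real
  assumes G: "finite G" and J: "finite J" "J \<noteq> {}"
    and D: "\<And>s. s \<in> J \<Longrightarrow> D s \<subseteq> G \<and> card (D s) = m"
    and m: "0 < m" and \<sigma>: "\<sigma>\<^sup>2 = 1" and c: "0 \<le> c"
  defines "P \<equiv> PiM G (\<lambda>_. std_normal)"
  shows "measure P {\<xi> \<in> space P. \<exists>s\<in>J. c * sqrt (2 * real m * ln (card J)) \<le> \<sigma> * (\<Sum>x\<in>D s. \<xi> x)}
      \<le> real (card J) powr (1 - c\<^sup>2)"
proof -
  have K: "1 \<le> real (card J)" using J by (simp add: Suc_le_eq card_gt_0_iff)
  let ?t = "c * sqrt (2 * real m * ln (card J))"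
  let ?w = "\<lambda>s x. \<sigma> * indicator (D s) x"
  have sq: "(\<Sum>x\<in>G. (?w s x)\<^sup>2) \<le> real m" if "s \<in> J" for s
    using D[OF that] by (simp only: indicator_weights[OF G] \<sigma>)
  have lin: "(\<Sum>x\<in>G. ?w s x * \<xi> x) = \<sigma> * (\<Sum>x\<in>D s. \<xi> x)" if "s \<in> J" for s and \<xi> :: "'i \<Rightarrow> real"
    using D[OF that] by (simp only: indicator_weights[OF G])
  have "measure P {\<xi> \<in> space P. \<exists>s\<in>J. ?t \<le> (\<Sum>x\<in>G. ?w s x * \<xi> x)}
      \<le> (\<Sum>s\<in>J. exp (- ?t\<^sup>2 / (2 * real m)))"
    unfolding P_def using K c by (intro gaussian_union_bound G J sq) auto
  also have "?t\<^sup>2 = c\<^sup>2 * (2 * real m * ln (card J))"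
    using K by (simp add: power_mult_distrib)
  also have "(\<Sum>s\<in>J. exp (- (c\<^sup>2 * (2 * real m * ln (card J))) / (2 * real m)))
      = real (card J) * exp (- c\<^sup>2 * ln (card J))"
    using m by simp
  also have "\<dots> = real (card J) powr (1 - c\<^sup>2)"
    using K by (simp add: powr_def left_diff_distrib exp_diff exp_minus field_simps)
  finally show ?thesis
    by (simp only: lin cong: bex_cong)
qed

section \<open>Counting subsets by their distance to a fixed set\<close>

text \<open>Expand the product over \<open>I\<close>: an element of \<open>A0\<close> is either kept (factor \<open>1\<close>) or dropped (factor \<open>f\<close>), any
other element is either left out (factor \<open>1\<close>) or added (factor \<open>g\<close>). This generating function replaces
all estimates of binomial coefficients.\<close>

lemma sum_Pow_weight_symm_diff:
  fixes f g :: "'c::comm_semiring_1"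
  assumes "finite I" "A0 \<subseteq> I"
  shows "(\<Sum>A\<in>Pow I. f ^ card (A0 - A) * g ^ card (A - A0)) = (1 + f) ^ card A0 * (1 + g) ^ card (I - A0)"
proof -
  let ?f1 = "\<lambda>i. if i \<in> A0 then 1 else g" and ?f2 = "\<lambda>i. if i \<in> A0 then f else 1"
  have fin: "finite A0" using assms finite_subset by blast
  have "(\<Prod>i\<in>I. ?f1 i + ?f2 i) = (\<Sum>A\<in>Pow I. (\<Prod>i\<in>A. ?f1 i) * (\<Prod>i\<in>I - A. ?f2 i))"
    by (rule prod_add) fact
  also have "\<dots> = (\<Sum>A\<in>Pow I. f ^ card (A0 - A) * g ^ card (A - A0))"
  proof (rule sum.cong[OF refl])
    fix A assume A: "A \<in> Pow I"
    then have "finite A" using assms finite_subset by blast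
    moreover have "(I - A) \<inter> A0 = A0 - A" "A \<inter> - A0 = A - A0" using A assms by auto
    ultimately show "(\<Prod>i\<in>A. ?f1 i) * (\<Prod>i\<in>I - A. ?f2 i) = f ^ card (A0 - A) * g ^ card (A - A0)"
      using assms fin by (simp add: prod.If_cases mult.commute)
  qed
  also have "(\<Prod>i\<in>I. ?f1 i + ?f2 i) = (\<Prod>i\<in>I. if i \<in> A0 then 1 + f else 1 + g)"
    by (intro prod.cong) (auto simp: add.commute)
  also have "\<dots> = (1 + f) ^ card A0 * (1 + g) ^ card (I - A0)"
  proof -
    have "I \<inter> A0 = A0" "I \<inter> - A0 = I - A0" using assms by auto
    then show ?thesis using assms by (simp add: prod.If_cases)
  qed
  finally show ?thesis by simp
qed

section \<open>Strong signals and unfavourable noise\<close>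

text \<open>The excess of \<open>b\<close> over \<open>1\<close> is distributed in portions of this relative size: with \<open>\<epsilon> = slack b\<close>, the number
\<open>(1 - 2 * \<epsilon>) * b\<close> is the midpoint of \<open>1\<close> and \<open>b\<close>.\<close>

definition slack :: "real \<Rightarrow> real" where
  "slack b = (b - 1) / (4 * b)"

text \<open>The \<open>powr\<close> terms, doubled for lower and upper deviations, bound the extreme row and column sums; the third summand
comes from the interaction term and the last one from the distant competitors.\<close>

definition noise_bound :: "real \<Rightarrow> nat \<Rightarrow> nat \<Rightarrow> real" where
  "noise_bound b n m = 2 * real n powr (1 - ((1 + b) / 2)\<^sup>2) + 2 * real m powr (1 - ((1 + b) / 2)\<^sup>2)
     + exp 4 / n + 2 * exp (- real (n + m))"

text \<open>A fixed true support together with the inequalities that hold once \<open>bound_B\<close> is at least \<open>b\<close>,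
written without quotients. The constant in \<open>sparse\<close> is \<open>3 / (\<epsilon>\<^sup>2 * \<delta>)\<close> for the \<open>\<epsilon>\<close> and \<open>\<delta>\<close> defined
below.\<close>

locale strong_signal =
  fixes N M n m :: nat and a b :: real and A0 B0 :: "nat set"
  assumes A0: "A0 \<subseteq> {1..N}" "card A0 = n" and B0: "B0 \<subseteq> {1..M}" "card B0 = m"
    and n: "2 \<le> n" "2 * n \<le> N" and m: "2 \<le> m" "2 * m \<le> M"
    and a: "0 < a" and b: "1 < b"
    and row_signal: "b * (sqrt 2 * (sqrt (ln (real n)) + sqrt (ln (real N - real n)))) \<le> a * sqrt (real m)"
    and col_signal: "b * (sqrt 2 * (sqrt (ln (real m)) + sqrt (ln (real M - real m)))) \<le> a * sqrt (real n)"
    and total_signal: "2 * b\<^sup>2 * (real n * ln (real N / real n) + real m * ln (real M / real m)) \<le> a\<^sup>2 * (real n * real m)"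
    and sparse: "24 / slack b ^ 4 \<le> ln (real N / real n)" "24 / slack b ^ 4 \<le> ln (real M / real m)"
begin

text \<open>Extreme row and column sums may exceed their typical size by the factor \<open>c\<close>. The fraction of the signal that
other noise may use up is \<open>\<epsilon>\<close>, and \<open>\<delta>\<close> separates near from distant competitors; its value makes the
exponent of the interaction term at least twice the entropy it has to beat.\<close>

definition c :: real where "c = (1 + b) / 2"
definition \<epsilon> :: real where "\<epsilon> = slack b"
definition \<delta> :: real where "\<delta> = \<epsilon>\<^sup>2 / 8"

abbreviation rows_missed :: "nat set \<Rightarrow> real" where "rows_missed A \<equiv> real (card (A0 - A))"
abbreviation cols_missed :: "nat set \<Rightarrow> real" where "cols_missed B \<equiv> real (card (B0 - B))"

definition entries_missed :: "nat set \<Rightarrow> nat set \<Rightarrow> real" where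
  "entries_missed A B = rows_missed A * m + n * cols_missed B - rows_missed A * cols_missed B"

definition competitors :: "(nat set \<times> nat set) set" where
  "competitors = {(A, B). A \<subseteq> {1..N} \<and> card A = n \<and> B \<subseteq> {1..M} \<and> card B = m}"

text \<open>Competitors that miss rows only, or columns only, are left out here since their interaction term vanishes.\<close>

definition near :: "(nat set \<times> nat set) set" where
  "near = {(A, B) \<in> competitors. A0 - A \<noteq> {} \<and> B0 - B \<noteq> {} \<and>
     rows_missed A \<le> \<delta> * n \<and> cols_missed B \<le> \<delta> * m}"

definition far :: "(nat set \<times> nat set) set" where
  "far = {(A, B) \<in> competitors. \<delta> * (n * m) \<le> entries_missed A B}"

text \<open>The entries that a competitor misses depend only on the rows and columns of the true support that it
keeps, so these are the indices for the noise lost on the true support.\<close>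

definition far_kept :: "(nat set \<times> nat set) set" where
  "far_kept = {(A, B) \<in> Pow A0 \<times> Pow B0. \<delta> * (n * m) \<le> card (A0 \<times> B0 - A \<times> B)}"

text \<open>The product \<open>\<alpha> \<beta>\<close>, which corrects the error made by exchanging rows and columns independently of each other.\<close>

definition interaction :: "nat set \<Rightarrow> nat set \<Rightarrow> nat \<times> nat \<Rightarrow> real" where
  "interaction A B x = (indicator A0 (fst x) - indicator A (fst x)) * (indicator B0 (snd x) - indicator B (snd x))"

definition low_row :: "(nat \<times> nat \<Rightarrow> real) \<Rightarrow> bool" where
  "low_row \<xi> \<longleftrightarrow> (\<exists>i\<in>A0. c * sqrt (2 * real m * ln (card A0)) \<le> -1 * (\<Sum>x\<in>{i} \<times> B0. \<xi> x))"
definition high_row :: "(nat \<times> nat \<Rightarrow> real) \<Rightarrow> bool" where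
  "high_row \<xi> \<longleftrightarrow> (\<exists>i\<in>{1..N} - A0. c * sqrt (2 * real m * ln (card ({1..N} - A0))) \<le> 1 * (\<Sum>x\<in>{i} \<times> B0. \<xi> x))"
definition low_col :: "(nat \<times> nat \<Rightarrow> real) \<Rightarrow> bool" where
  "low_col \<xi> \<longleftrightarrow> (\<exists>j\<in>B0. c * sqrt (2 * real n * ln (card B0)) \<le> -1 * (\<Sum>x\<in>A0 \<times> {j}. \<xi> x))"
definition high_col :: "(nat \<times> nat \<Rightarrow> real) \<Rightarrow> bool" where
  "high_col \<xi> \<longleftrightarrow> (\<exists>j\<in>{1..M} - B0. c * sqrt (2 * real n * ln (card ({1..M} - B0))) \<le> 1 * (\<Sum>x\<in>A0 \<times> {j}. \<xi> x))"
definition high_interaction :: "(nat \<times> nat \<Rightarrow> real) \<Rightarrow> bool" where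
  "high_interaction \<xi> \<longleftrightarrow> (\<exists>(A, B)\<in>near. \<epsilon> * a * (rows_missed A * m + n * cols_missed B)
      \<le> (\<Sum>x\<in>grid N M. interaction A B x * \<xi> x))"
definition low_far :: "(nat \<times> nat \<Rightarrow> real) \<Rightarrow> bool" where
  "low_far \<xi> \<longleftrightarrow> (\<exists>(A, B)\<in>far_kept. \<epsilon> * a * card (A0 \<times> B0 - A \<times> B) \<le> -1 * (\<Sum>x\<in>A0 \<times> B0 - A \<times> B. \<xi> x))"
definition high_far :: "(nat \<times> nat \<Rightarrow> real) \<Rightarrow> bool" where
  "high_far \<xi> \<longleftrightarrow> (\<exists>(A, B)\<in>far. (1 - \<epsilon>) * a * entries_missed A B \<le> (\<Sum>x\<in>A \<times> B - A0 \<times> B0. \<xi> x))"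

definition bad_noise :: "(nat \<times> nat \<Rightarrow> real) \<Rightarrow> bool" where
  "bad_noise \<xi> \<longleftrightarrow> low_row \<xi> \<or> high_row \<xi> \<or> low_col \<xi> \<or> high_col \<xi> \<or>
     high_interaction \<xi> \<or> low_far \<xi> \<or> high_far \<xi>"

lemma \<epsilon>_bounds: "0 < \<epsilon>" "\<epsilon> < 1 / 4" and \<delta>_bounds: "0 < \<delta>" "\<delta> < \<epsilon>"
  and c_bounds: "1 < c" and c_eq: "c = (1 - 2 * \<epsilon>) * b"
proof -
  show e: "0 < \<epsilon>" "\<epsilon> < 1 / 4" using b by (auto simp: \<epsilon>_def slack_def field_simps)
  show "0 < \<delta>" using e by (simp add: \<delta>_def)
  have "\<epsilon> * \<epsilon> < 8 * \<epsilon>" using e by simp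
  then show "\<delta> < \<epsilon>" by (simp add: \<delta>_def power2_eq_square)
  show "1 < c" "c = (1 - 2 * \<epsilon>) * b" using b by (auto simp: c_def \<epsilon>_def slack_def field_simps)
qed

lemma finite_supports [simp]: "finite A0" "finite B0"
  using A0(1) B0(1) by (auto intro: finite_subset)

lemma card_outside: "real (card ({1..N} - A0)) = real N - real n" "real (card ({1..M} - B0)) = real M - real m"
  using A0 B0 n m by (auto simp: card_Diff_subset of_nat_diff)

lemma competitorsD:
  assumes "(A, B) \<in> competitors"
  shows "A \<subseteq> {1..N}" "card A = n" "B \<subseteq> {1..M}" "card B = m" "finite A" "finite B"
  using assms by (auto simp: competitors_def intro: finite_subset)

lemma card_swapped:
  assumes "(A, B) \<in> competitors"
  shows "card (A - A0) = card (A0 - A)" "card (B - B0) = card (B0 - B)"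
proof -
  note D = competitorsD[OF assms]
  show "card (A - A0) = card (A0 - A)"
    using D A0 card_Diff_subset_Int[of A A0] card_Diff_subset_Int[of A0 A] by (simp add: Int_commute)
  show "card (B - B0) = card (B0 - B)"
    using D B0 card_Diff_subset_Int[of B B0] card_Diff_subset_Int[of B0 B] by (simp add: Int_commute)
qed

lemma card_block_diff:
  fixes A A' B B' :: "nat set"
  assumes "finite A" "finite B"
  shows "real (card (A \<times> B - A' \<times> B')) = real (card (A - A')) * card B + card A * real (card (B - B')) - real (card (A - A')) * card (B - B')"
proof -
  have "A \<times> B - A' \<times> B' = (A - A') \<times> B \<union> (A \<inter> A') \<times> (B - B')" by auto
  moreover have "card ((A - A') \<times> B \<union> (A \<inter> A') \<times> (B - B')) = card ((A - A') \<times> B) + card ((A \<inter> A') \<times> (B - B'))"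
    using assms by (intro card_Un_disjoint) auto
  moreover have "real (card A) = card (A - A') + card (A \<inter> A')"
    using assms by (simp add: card_Diff_subset_Int card_mono flip: of_nat_add)
  ultimately show ?thesis by (simp add: card_cartesian_product algebra_simps)
qed

lemma card_lost_entries: "real (card (A0 \<times> B0 - A \<times> B)) = entries_missed A B"
  using A0 B0 by (simp add: card_block_diff entries_missed_def)

lemma card_gained_entries:
  assumes "(A, B) \<in> competitors"
  shows "real (card (A \<times> B - A0 \<times> B0)) = entries_missed A B"
  using competitorsD[OF assms] by (simp add: card_block_diff entries_missed_def card_swapped[OF assms])

lemma missed_le: "rows_missed A \<le> n" "cols_missed B \<le> m"
  using A0 B0 by (auto intro!: card_mono)

lemma entries_missed_ge:
  shows "rows_missed A * m \<le> entries_missed A B" and "n * cols_missed B \<le> entries_missed A B"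
proof -
  have "rows_missed A * cols_missed B \<le> n * cols_missed B" "rows_missed A * cols_missed B \<le> rows_missed A * m"
    using missed_le by (simp_all add: mult_mono)
  then show "rows_missed A * m \<le> entries_missed A B" "n * cols_missed B \<le> entries_missed A B"
    unfolding entries_missed_def by linarith+
qed

section \<open>Correctness of the maximizer outside the bad event\<close>

text \<open>Expanding the product of the two indicator differences gives four rectangles.\<close>

lemma interaction_sum:
  assumes "(A, B) \<in> competitors"
  shows "(\<Sum>x\<in>grid N M. interaction A B x * \<xi> x) =
    sum \<xi> (A0 \<times> B0) - sum \<xi> (A \<times> B0) - sum \<xi> (A0 \<times> B) + sum \<xi> (A \<times> B)"
proof -
  note D = competitorsD[OF assms]
  have block: "(\<Sum>x\<in>grid N M. indicator (A \<times> B) x * \<xi> x) = sum \<xi> (A \<times> B)"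
    if "A \<subseteq> {1..N}" "B \<subseteq> {1..M}" for A B
    using indicator_weights(2)[of "grid N M" "A \<times> B" 1 \<xi>] that
    by (simp only: mult_1 grid_def Sigma_mono finite_cartesian_product finite_atLeastAtMost)
  have "interaction A B x = indicator (A0 \<times> B0) x - indicator (A \<times> B0) x - indicator (A0 \<times> B) x + indicator (A \<times> B) x" for x
    by (cases x) (simp add: interaction_def indicator_times algebra_simps)
  then have "(\<Sum>x\<in>grid N M. interaction A B x * \<xi> x) =
      (\<Sum>x\<in>grid N M. indicator (A0 \<times> B0) x * \<xi> x - indicator (A \<times> B0) x * \<xi> x
        - indicator (A0 \<times> B) x * \<xi> x + indicator (A \<times> B) x * \<xi> x)"
    by (simp only: left_diff_distrib distrib_right)
  then show ?thesis
    by (simp only: sum.distrib sum_subtractf block A0(1) B0(1) D)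
qed

text \<open>Dropping a true row loses at most the first threshold and adding a false one gains at most the second.
The hypothesis is \<open>row_signal\<close> or \<open>col_signal\<close>; as \<open>c\<close> is smaller than \<open>b\<close>, a fraction \<open>2 \<epsilon>\<close> of the signal is left over.\<close>

lemma row_and_column_thresholds_le:
  fixes x y s :: real
  assumes "b * (sqrt 2 * (sqrt x + sqrt y)) \<le> a * sqrt s" "0 \<le> s"
  shows "c * sqrt (2 * s * x) + c * sqrt (2 * s * y) \<le> (1 - 2 * \<epsilon>) * a * s"
proof -
  have "c * sqrt (2 * s * x) + c * sqrt (2 * s * y)
      = (1 - 2 * \<epsilon>) * sqrt s * (b * (sqrt 2 * (sqrt x + sqrt y)))"
    by (simp add: c_eq real_sqrt_mult algebra_simps)
  also have "\<dots> \<le> (1 - 2 * \<epsilon>) * sqrt s * (a * sqrt s)"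
    using assms \<epsilon>_bounds by (intro mult_left_mono) auto
  also have "\<dots> = (1 - 2 * \<epsilon>) * a * s"
    using assms by (simp add: algebra_simps)
  finally show ?thesis .
qed

lemma row_exchange:
  assumes AB: "(A, B) \<in> competitors" and good: "\<not> low_row \<xi>" "\<not> high_row \<xi>"
  shows "- ((1 - 2 * \<epsilon>) * a * (rows_missed A * m)) \<le> sum \<xi> (A0 \<times> B0) - sum \<xi> (A \<times> B0)"
proof -
  note D = competitorsD[OF AB]
  let ?r = "\<lambda>i. \<Sum>x\<in>{i} \<times> B0. \<xi> x"
  let ?s = "c * sqrt (2 * real m * ln (real n))" and ?t = "c * sqrt (2 * real m * ln (real N - real n))"
  have rows: "sum \<xi> (E \<times> B0) = sum ?r E" for E
    by (simp add: sum.cartesian_product')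
  have "sum \<xi> (A0 \<times> B0) - sum \<xi> (A \<times> B0) = sum ?r (A0 - A) - sum ?r (A - A0)"
    using D sum.Int_Diff[of A0 ?r A] sum.Int_Diff[of A ?r A0] by (simp add: rows[of A0] rows[of A] Int_commute)
  moreover have "(\<Sum>i\<in>A0 - A. - ?s) \<le> sum ?r (A0 - A)"
    using good(1) A0 by (intro sum_mono) (force simp: low_row_def not_le)
  moreover have "sum ?r (A - A0) \<le> (\<Sum>i\<in>A - A0. ?t)"
  proof (rule sum_mono)
    fix i assume "i \<in> A - A0"
    then have "i \<in> {1..N} - A0" using D by blast
    then show "?r i \<le> ?t" using good(2) unfolding high_row_def card_outside by force
  qed
  moreover have "rows_missed A * (?s + ?t) \<le> rows_missed A * ((1 - 2 * \<epsilon>) * a * m)"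
    using row_and_column_thresholds_le[OF row_signal] by (intro mult_left_mono) auto
  ultimately show ?thesis
    by (simp add: card_swapped[OF AB] algebra_simps)
qed

lemma col_exchange:
  assumes AB: "(A, B) \<in> competitors" and good: "\<not> low_col \<xi>" "\<not> high_col \<xi>"
  shows "- ((1 - 2 * \<epsilon>) * a * (n * cols_missed B)) \<le> sum \<xi> (A0 \<times> B0) - sum \<xi> (A0 \<times> B)"
proof -
  note D = competitorsD[OF AB]
  let ?r = "\<lambda>j. \<Sum>x\<in>A0 \<times> {j}. \<xi> x"
  let ?s = "c * sqrt (2 * real n * ln (real m))" and ?t = "c * sqrt (2 * real n * ln (real M - real m))"
  have cols: "sum \<xi> (A0 \<times> E) = sum ?r E" for E
    using sum.swap[of "\<lambda>i j. \<xi> (i, j)" E A0] by (simp add: sum.cartesian_product')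
  have "sum \<xi> (A0 \<times> B0) - sum \<xi> (A0 \<times> B) = sum ?r (B0 - B) - sum ?r (B - B0)"
    using D sum.Int_Diff[of B0 ?r B] sum.Int_Diff[of B ?r B0] by (simp add: cols[of B0] cols[of B] Int_commute)
  moreover have "(\<Sum>j\<in>B0 - B. - ?s) \<le> sum ?r (B0 - B)"
    using good(1) B0 by (intro sum_mono) (force simp: low_col_def not_le)
  moreover have "sum ?r (B - B0) \<le> (\<Sum>j\<in>B - B0. ?t)"
  proof (rule sum_mono)
    fix j assume "j \<in> B - B0"
    then have "j \<in> {1..M} - B0" using D by blast
    then show "?r j \<le> ?t" using good(2) unfolding high_col_def card_outside by force
  qed
  moreover have "cols_missed B * (?s + ?t) \<le> cols_missed B * ((1 - 2 * \<epsilon>) * a * n)"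
    using row_and_column_thresholds_le[OF col_signal] by (intro mult_left_mono) auto
  ultimately show ?thesis
    by (simp add: card_swapped[OF AB] algebra_simps)
qed

lemma few_missed_if_not_far:
  assumes AB: "(A, B) \<in> competitors" and "(A, B) \<notin> far"
  shows "rows_missed A \<le> \<delta> * n" "cols_missed B \<le> \<delta> * m"
proof -
  have lt: "entries_missed A B < \<delta> * (n * m)" using assms by (auto simp: far_def)
  have "rows_missed A * m \<le> (\<delta> * n) * m" "n * cols_missed B \<le> n * (\<delta> * m)"
    using lt entries_missed_ge(1)[of A B] entries_missed_ge(2)[of B A] by (simp_all add: algebra_simps)
  then show "rows_missed A \<le> \<delta> * n" "cols_missed B \<le> \<delta> * m"
    using n m by (simp_all add: mult_le_cancel_right mult_le_cancel_left)
qed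

text \<open>The row exchange, the column exchange and the interaction term together use up at most \<open>(1 - \<epsilon>) a (k m + n l)\<close>.
Since \<open>k \<le> \<delta> n\<close>, the overlap \<open>k l\<close> lowers the signal \<open>a d\<close> only to \<open>(1 - \<delta>) a (k m + n l)\<close>, and \<open>\<delta> < \<epsilon>\<close>.\<close>

lemma noise_beaten_near:
  assumes AB: "(A, B) \<in> competitors" and not_far: "(A, B) \<notin> far"
    and ne: "A \<times> B \<noteq> A0 \<times> B0" and good: "\<not> bad_noise \<xi>"
  shows "sum \<xi> (A \<times> B) - sum \<xi> (A0 \<times> B0) < a * entries_missed A B"
proof -
  note D = competitorsD[OF AB]
  let ?W = "\<Sum>x\<in>grid N M. interaction A B x * \<xi> x"
  let ?u = "rows_missed A * m + n * cols_missed B"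
  have "A0 - A \<noteq> {} \<or> B0 - B \<noteq> {}"
  proof (rule ccontr)
    assume "\<not> ?thesis"
    then have "A0 = A" "B0 = B"
      using D A0 B0 card_subset_eq[of A A0] card_subset_eq[of B B0] by auto
    with ne show False by simp
  qed
  then have "0 < rows_missed A \<or> 0 < cols_missed B" by (auto simp: card_gt_0_iff)
  then have u: "0 < ?u"
    using n m by (auto intro: add_pos_nonneg add_nonneg_pos)
  have W: "?W \<le> \<epsilon> * a * ?u"
  proof (cases "A0 - A = {} \<or> B0 - B = {}")
    case True
    then have "A0 = A \<or> B0 = B"
      using D A0 B0 card_subset_eq[of A A0] card_subset_eq[of B B0] by auto
    then have "?W = 0" by (auto simp: interaction_def)
    then show ?thesis using u a \<epsilon>_bounds by simp
  next
    case False
    then have "(A, B) \<in> near" using AB few_missed_if_not_far[OF AB not_far] by (simp add: near_def)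
    then show ?thesis using good unfolding bad_noise_def high_interaction_def by force
  qed
  have "\<delta> * n * cols_missed B \<le> \<delta> * ?u"
    using \<delta>_bounds by (simp add: algebra_simps)
  moreover have "rows_missed A * cols_missed B \<le> \<delta> * n * cols_missed B"
    using few_missed_if_not_far[OF AB not_far] by (intro mult_right_mono) auto
  ultimately have "(1 - \<delta>) * ?u \<le> entries_missed A B"
    unfolding entries_missed_def by (simp add: algebra_simps)
  then have "(1 - \<delta>) * a * ?u \<le> a * entries_missed A B"
    using a by (simp add: mult.assoc mult.left_commute)
  moreover have "(1 - \<epsilon>) * (a * ?u) < (1 - \<delta>) * (a * ?u)"
    using \<delta>_bounds a u by (intro mult_strict_right_mono) auto
  moreover have "- ((1 - 2 * \<epsilon>) * a * ?u) - \<epsilon> * a * ?u \<le> sum \<xi> (A0 \<times> B0) - sum \<xi> (A \<times> B)"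
    using row_exchange[OF AB, of \<xi>] col_exchange[OF AB, of \<xi>] W interaction_sum[OF AB, of \<xi>] good
    unfolding bad_noise_def distrib_left by simp
  ultimately show ?thesis by (simp add: algebra_simps)
qed

text \<open>The two parts of the noise use up less than the fractions \<open>\<epsilon>\<close> and \<open>1 - \<epsilon>\<close> of the signal.\<close>

lemma noise_beaten_far:
  assumes far: "(A, B) \<in> far" and good: "\<not> bad_noise \<xi>"
  shows "sum \<xi> (A \<times> B) - sum \<xi> (A0 \<times> B0) < a * entries_missed A B"
proof -
  have AB: "(A, B) \<in> competitors" using far by (auto simp: far_def)
  note D = competitorsD[OF AB]
  have lost: "A0 \<times> B0 - (A \<inter> A0) \<times> (B \<inter> B0) = A0 \<times> B0 - A \<times> B" by auto
  have "(A \<inter> A0, B \<inter> B0) \<in> far_kept"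
    using far unfolding far_kept_def far_def by (simp add: card_lost_entries entries_missed_def Diff_Int)
  then have "- sum \<xi> (A0 \<times> B0 - A \<times> B) < \<epsilon> * a * entries_missed A B"
    using good unfolding bad_noise_def low_far_def
    by (force simp: card_lost_entries entries_missed_def Diff_Int lost)
  moreover have "sum \<xi> (A \<times> B - A0 \<times> B0) < (1 - \<epsilon>) * a * entries_missed A B"
    using good far unfolding bad_noise_def high_far_def by force
  moreover have "sum \<xi> (A \<times> B) - sum \<xi> (A0 \<times> B0) = sum \<xi> (A \<times> B - A0 \<times> B0) - sum \<xi> (A0 \<times> B0 - A \<times> B)"
    using D sum.Int_Diff[of "A \<times> B" \<xi> "A0 \<times> B0"] sum.Int_Diff[of "A0 \<times> B0" \<xi> "A \<times> B"]
    by (simp add: Int_commute)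
  ultimately show ?thesis by (simp add: algebra_simps)
qed

text \<open>The true block is ahead by at least \<open>a d\<close> in mean, more than any competitor can make up.
The inequality is strict, so the true block is the only maximizer.\<close>

lemma max_selector_eq_support:
  assumes S: "S \<in> grid N M \<rightarrow>\<^sub>E UNIV"
    and S_in: "\<And>x. x \<in> A0 \<times> B0 \<Longrightarrow> a \<le> S x"
    and S_out: "\<And>x. x \<in> grid N M \<Longrightarrow> x \<notin> A0 \<times> B0 \<Longrightarrow> S x = 0"
    and good: "\<not> bad_noise \<xi>"
  shows "max_selector N M n m (\<lambda>x\<in>grid N M. S x + \<xi> x) = A0 \<times> B0"
proof -
  let ?Y = "\<lambda>x\<in>grid N M. S x + \<xi> x" and ?C = "max_selector N M n m (\<lambda>x\<in>grid N M. S x + \<xi> x)"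
  have arg: "is_arg_max (\<lambda>C. sum ?Y C) (\<lambda>C. C \<in> submatrices N M n m) ?C"
    using n m by (intro is_arg_max_max_selector) auto
  then have "?C \<in> submatrices N M n m" by (simp add: is_arg_max_def)
  then obtain A B where C: "?C = A \<times> B" and AB: "(A, B) \<in> competitors"
    by (auto simp: submatrices_def competitors_def)
  note D = competitorsD[OF AB]
  have C0: "A0 \<times> B0 \<in> submatrices N M n m" using A0 B0 unfolding submatrices_def by blast
  have grid: "A \<times> B \<subseteq> grid N M" "A0 \<times> B0 \<subseteq> grid N M" using D A0 B0 by (auto simp: grid_def)
  have Y: "sum ?Y E = sum S E + sum \<xi> E" if "E \<subseteq> grid N M" for E
    unfolding sum.distrib[symmetric] using that by (intro sum.cong) auto
  show ?thesis
  proof (rule ccontr)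
    assume "?C \<noteq> A0 \<times> B0"
    then have ne: "A \<times> B \<noteq> A0 \<times> B0" by (simp add: C)
    have "sum \<xi> (A \<times> B) - sum \<xi> (A0 \<times> B0) < a * entries_missed A B"
      using noise_beaten_near[OF AB _ ne good] noise_beaten_far[OF _ good] by blast
    moreover have "a * entries_missed A B \<le> sum S (A0 \<times> B0) - sum S (A \<times> B)"
    proof -
      have "(\<Sum>x\<in>A0 \<times> B0 - A \<times> B. a) \<le> sum S (A0 \<times> B0 - A \<times> B)"
        by (intro sum_mono S_in) auto
      moreover have "sum S (A \<times> B - A0 \<times> B0) = 0"
        using grid by (intro sum.neutral) (auto intro: S_out)
      ultimately show ?thesis
        using D sum.Int_Diff[of "A \<times> B" S "A0 \<times> B0"] sum.Int_Diff[of "A0 \<times> B0" S "A \<times> B"]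
        by (simp add: Int_commute card_lost_entries mult.commute)
    qed
    ultimately have "sum ?Y (A \<times> B) < sum ?Y (A0 \<times> B0)"
      by (simp only: Y grid)
    then show False using arg C0 C by (auto simp: is_arg_max_def)
  qed
qed

section \<open>Row and column sums are rarely extreme\<close>

abbreviation prob_noise :: "((nat \<times> nat \<Rightarrow> real) \<Rightarrow> bool) \<Rightarrow> real" where
  "prob_noise Q \<equiv> measure (noise_law N M) {\<xi> \<in> space (noise_law N M). Q \<xi>}"

lemma finite_grid: "finite (grid N M)" by (simp add: grid_def)

lemma finite_families: "finite near" "finite far" "finite far_kept"
proof -
  have "finite competitors"
    by (rule finite_subset[of _ "Pow {1..N} \<times> Pow {1..M}"]) (auto simp: competitors_def)
  then show "finite near" "finite far"
    by (rule finite_subset[rotated]; force simp: near_def far_def)+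
  show "finite far_kept"
    by (rule finite_subset[of _ "Pow A0 \<times> Pow B0"]) (auto simp: far_kept_def)
qed

text \<open>There are more rows outside the support than inside, and the bound for an extreme row sum decreases
with the number of rows.\<close>

lemma powr_larger_complement:
  assumes "0 < x" "2 * x \<le> y"
  shows "(real y - real x) powr (1 - c\<^sup>2) \<le> real x powr (1 - c\<^sup>2)"
proof -
  have "1 \<le> c\<^sup>2" using c_bounds by (simp add: one_le_power)
  moreover have "real x \<le> real y - real x" using assms by linarith
  ultimately show ?thesis using assms by (intro powr_mono2') auto
qed

lemma row_block: "i \<in> {1..N} \<Longrightarrow> {i} \<times> B0 \<subseteq> grid N M \<and> card ({i} \<times> B0) = m"
  and col_block: "j \<in> {1..M} \<Longrightarrow> A0 \<times> {j} \<subseteq> grid N M \<and> card (A0 \<times> {j}) = n"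
  using A0 B0 by (auto simp: grid_def card_cartesian_product)

lemma prob_low_row: "prob_noise low_row \<le> real n powr (1 - c\<^sup>2)"
proof -
  have "A0 \<noteq> {}" using A0(2) n by auto
  then have "prob_noise low_row \<le> real (card A0) powr (1 - c\<^sup>2)"
    unfolding low_row_def noise_law_def using A0(1) m c_bounds
    by (intro gaussian_block_max finite_grid finite_supports row_block) auto
  then show ?thesis using A0(2) by simp
qed

lemma prob_high_row: "prob_noise high_row \<le> real n powr (1 - c\<^sup>2)"
proof -
  have "card ({1..N} - A0) \<noteq> 0" using card_outside(1) n by linarith
  then have "{1..N} - A0 \<noteq> {}" by (metis card.empty)
  then have "prob_noise high_row \<le> real (card ({1..N} - A0)) powr (1 - c\<^sup>2)"
    unfolding high_row_def noise_law_def using m c_bounds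
    by (intro gaussian_block_max finite_grid row_block) auto
  also have "\<dots> \<le> real n powr (1 - c\<^sup>2)"
    unfolding card_outside using n by (intro powr_larger_complement) auto
  finally show ?thesis .
qed

lemma prob_low_col: "prob_noise low_col \<le> real m powr (1 - c\<^sup>2)"
proof -
  have "B0 \<noteq> {}" using B0(2) m by auto
  then have "prob_noise low_col \<le> real (card B0) powr (1 - c\<^sup>2)"
    unfolding low_col_def noise_law_def using B0(1) n c_bounds
    by (intro gaussian_block_max finite_grid finite_supports col_block) auto
  then show ?thesis using B0(2) by simp
qed

lemma prob_high_col: "prob_noise high_col \<le> real m powr (1 - c\<^sup>2)"
proof -
  have "card ({1..M} - B0) \<noteq> 0" using card_outside(2) m by linarith
  then have "{1..M} - B0 \<noteq> {}" by (metis card.empty)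
  then have "prob_noise high_col \<le> real (card ({1..M} - B0)) powr (1 - c\<^sup>2)"
    unfolding high_col_def noise_law_def using n c_bounds
    by (intro gaussian_block_max finite_grid col_block) auto
  also have "\<dots> \<le> real m powr (1 - c\<^sup>2)"
    unfolding card_outside using m by (intro powr_larger_complement) auto
  finally show ?thesis .
qed

section \<open>The interaction term is rarely large\<close>

text \<open>The summand of the generating function for row sets times that for column sets. Bounding the probability for each competitor
by a multiple of such a weight makes the union bound summable.\<close>

definition weight :: "real \<Rightarrow> real \<Rightarrow> real \<Rightarrow> real \<Rightarrow> nat set \<Rightarrow> nat set \<Rightarrow> real" where
  "weight f g f' g' A B = (f ^ card (A0 - A) * g ^ card (A - A0)) * (f' ^ card (B0 - B) * g' ^ card (B - B0))"

lemma sum_weight_le: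
  fixes f g f' g' :: real
  assumes J: "J \<subseteq> competitors" and pos: "0 \<le> f" "0 \<le> g" "0 \<le> f'" "0 \<le> g'"
  shows "(\<Sum>(A, B)\<in>J. weight f g f' g' A B)
    \<le> exp (n * f + (real N - n) * g + m * f' + (real M - m) * g')"
proof -
  have pow: "(1 + y) ^ k \<le> exp (real k * y)" if "0 \<le> y" for y :: real and k
    unfolding exp_of_nat_mult using that exp_ge_add_one_self[of y] by (intro power_mono) auto
  have sub: "J \<subseteq> Pow {1..N} \<times> Pow {1..M}" using J by (auto simp: competitors_def)
  have "(\<Sum>(A, B)\<in>J. weight f g f' g' A B) \<le> (\<Sum>(A, B)\<in>Pow {1..N} \<times> Pow {1..M}. weight f g f' g' A B)"
    using sub pos by (intro sum_mono2) (auto simp: weight_def)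
  also have "\<dots> = (\<Sum>A\<in>Pow {1..N}. f ^ card (A0 - A) * g ^ card (A - A0))
      * (\<Sum>B\<in>Pow {1..M}. f' ^ card (B0 - B) * g' ^ card (B - B0))"
    by (simp only: weight_def sum_product sum.cartesian_product)
  also have "\<dots> = ((1 + f) ^ n * (1 + g) ^ card ({1..N} - A0)) * ((1 + f') ^ m * (1 + g') ^ card ({1..M} - B0))"
    using A0 B0 by (simp only: sum_Pow_weight_symm_diff finite_atLeastAtMost)
  also have "\<dots> \<le> (exp (n * f) * exp (card ({1..N} - A0) * g)) * (exp (m * f') * exp (card ({1..M} - B0) * g'))"
    using pos by (intro mult_mono pow) auto
  also have "\<dots> = exp (n * f + (real N - n) * g + m * f' + (real M - m) * g')"
    unfolding card_outside by (simp add: exp_add)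
  finally show ?thesis .
qed

text \<open>The weights form a rank one matrix with entries in \<open>{-1, 0, 1}\<close> whose support has \<open>2 k\<close> rows and \<open>2 l\<close>
columns.\<close>

lemma interaction_variance:
  assumes "(A, B) \<in> competitors"
  shows "(\<Sum>x\<in>grid N M. (interaction A B x)\<^sup>2) = 4 * rows_missed A * cols_missed B"
proof -
  note D = competitorsD[OF assms]
  have sq: "(\<Sum>i\<in>{1..K}. (indicator E0 i - indicator E i)\<^sup>2) = real (card (E0 - E)) + card (E - E0)"
    if "E \<subseteq> {1..K}" "E0 \<subseteq> {1..K}" for K and E E0 :: "nat set"
  proof -
    have "(\<Sum>i\<in>{1..K}. (indicator E0 i - indicator E i)\<^sup>2)
        = (\<Sum>i\<in>{1..K}. (1 * indicator (E0 - E) i)\<^sup>2) + (\<Sum>i\<in>{1..K}. (1 * indicator (E - E0) i :: real)\<^sup>2)"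
      unfolding sum.distrib[symmetric] by (intro sum.cong) (auto simp: indicator_def)
    moreover have "E0 - E \<subseteq> {1..K}" "E - E0 \<subseteq> {1..K}" using that by auto
    ultimately show ?thesis
      by (simp only: indicator_weights finite_atLeastAtMost) simp
  qed
  have "(\<Sum>x\<in>grid N M. (interaction A B x)\<^sup>2)
      = (\<Sum>i\<in>{1..N}. (indicator A0 i - indicator A i)\<^sup>2) * (\<Sum>j\<in>{1..M}. (indicator B0 j - indicator B j)\<^sup>2)"
    unfolding sum_product sum.cartesian_product grid_def
    by (intro sum.cong) (auto simp: interaction_def power_mult_distrib)
  also have "\<dots> = (2 * rows_missed A) * (2 * cols_missed B)"
    using D A0 B0 card_swapped[OF assms] by (simp only: sq mult_2)
  finally show ?thesis by simp
qed

text \<open>A weaker form of \<open>row_signal\<close> and \<open>col_signal\<close>, which drops the mixed term of the square. It suffices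
for the interaction term, whose exponent gains a factor \<open>1 / \<delta>\<close>.\<close>

lemma sum_logs_le_signal:
  fixes x y s :: real
  assumes "b * (sqrt 2 * (sqrt x + sqrt y)) \<le> a * sqrt s" "0 \<le> s" "0 \<le> x" "0 \<le> y"
  shows "2 * (x + y) \<le> a\<^sup>2 * s"
proof -
  have le: "1 * (sqrt 2 * (sqrt x + sqrt y)) \<le> b * (sqrt 2 * (sqrt x + sqrt y))"
    using b assms by (intro mult_right_mono) auto
  have "(sqrt 2 * (sqrt x + sqrt y))\<^sup>2 \<le> (a * sqrt s)\<^sup>2"
  proof (rule power_mono)
    show "sqrt 2 * (sqrt x + sqrt y) \<le> a * sqrt s" using le assms(1) by linarith
  qed (use assms in simp)
  moreover have "(sqrt 2 * (sqrt x + sqrt y))\<^sup>2 = 2 * (x + y) + 4 * (sqrt x * sqrt y)"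
    using assms by (simp add: power_mult_distrib power2_sum)
  moreover have "0 \<le> sqrt x * sqrt y" "(a * sqrt s)\<^sup>2 = a\<^sup>2 * s"
    using assms by (simp_all add: power_mult_distrib)
  ultimately show ?thesis by linarith
qed

text \<open>For \<open>k \<le> \<delta> n\<close> and \<open>l \<le> \<delta> m\<close> the squared threshold over the variance gains a factor \<open>1 / \<delta>\<close>, because
\<open>(k m + n l)\<^sup>2 \<ge> k l (k m + n l) / \<delta>\<close>. With \<open>\<epsilon>\<^sup>2 = 8 \<delta>\<close> the exponent is at least twice the logarithm of a bound on
the number of ways to exchange \<open>k\<close> rows and \<open>l\<close> columns. One half goes into the weight, the other half gives the
factor \<open>1 / n\<close> since at least one row is exchanged.\<close>

lemma near_exponent:
  assumes AB: "(A, B) \<in> near"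
  shows "exp (- (\<epsilon> * a * (rows_missed A * m + n * cols_missed B))\<^sup>2 / (2 * (4 * rows_missed A * cols_missed B)))
    \<le> 1 / n * weight (1 / n) (1 / (real N - n)) (1 / m) (1 / (real M - m)) A B"
proof -
  have comp: "(A, B) \<in> competitors" using AB by (auto simp: near_def)
  let ?k = "rows_missed A" and ?l = "cols_missed B"
  let ?u = "?k * m + n * ?l"
  let ?x = "ln (real n)" and ?y = "ln (real N - real n)" and ?z = "ln (real m)" and ?w = "ln (real M - real m)"
  have k: "1 \<le> ?k" "?k \<le> \<delta> * n" and l: "1 \<le> ?l" "?l \<le> \<delta> * m"
    using AB by (auto simp: near_def Suc_le_eq card_gt_0_iff)
  have nn: "2 \<le> real N - real n" "2 \<le> real M - real m" "2 \<le> real n" "2 \<le> real m" using n m by linarith+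
  then have logs: "0 \<le> ?x" "0 \<le> ?y" "0 \<le> ?z" "0 \<le> ?w" by auto
  have rows: "2 * (?x + ?y) \<le> a\<^sup>2 * m" and cols: "2 * (?z + ?w) \<le> a\<^sup>2 * n"
    using sum_logs_le_signal[OF row_signal] sum_logs_le_signal[OF col_signal] logs by simp_all
  have "?k * ?l * ?u \<le> \<delta> * ?u\<^sup>2"
  proof -
    have "(?k * ?k * m) * ?l \<le> (?k * ?k * m) * (\<delta> * m)" "(?l * ?l * n) * ?k \<le> (?l * ?l * n) * (\<delta> * n)"
      using k l by (intro mult_left_mono; simp)+
    \<comment> \<open>The mixed term of \<open>?u\<^sup>2\<close> is dropped.\<close>
    moreover have "0 \<le> \<delta> * (2 * ?k * m * (n * ?l))" using \<delta>_bounds by simp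
    ultimately show ?thesis by (simp add: power2_eq_square algebra_simps)
  qed
  then have "8 * a\<^sup>2 * (?k * ?l * ?u) \<le> 8 * a\<^sup>2 * (\<delta> * ?u\<^sup>2)"
    by (intro mult_left_mono) auto
  also have "\<dots> = (\<epsilon> * a * ?u)\<^sup>2" by (simp add: \<delta>_def power_mult_distrib)
  finally have "8 * (?k * ?l) * (?k * (a\<^sup>2 * m) + ?l * (a\<^sup>2 * n)) \<le> (\<epsilon> * a * ?u)\<^sup>2"
    by (simp add: algebra_simps)
  moreover have "8 * (?k * ?l) * (?k * (2 * (?x + ?y)) + ?l * (2 * (?z + ?w)))
      \<le> 8 * (?k * ?l) * (?k * (a\<^sup>2 * m) + ?l * (a\<^sup>2 * n))"
    using rows cols by (intro mult_left_mono add_mono) auto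
  ultimately have "(2 * (?k * (?x + ?y) + ?l * (?z + ?w))) * (2 * (4 * ?k * ?l)) \<le> (\<epsilon> * a * ?u)\<^sup>2"
    by (simp add: algebra_simps)
  then have "2 * (?k * (?x + ?y) + ?l * (?z + ?w)) \<le> (\<epsilon> * a * ?u)\<^sup>2 / (2 * (4 * ?k * ?l))"
    using k l by (subst pos_le_divide_eq) auto
  moreover have "?x + (?k * ?x + ?k * ?y + ?l * ?z + ?l * ?w) \<le> 2 * (?k * (?x + ?y) + ?l * (?z + ?w))"
  proof -
    have "1 * ?x \<le> ?k * ?x" using k logs by (intro mult_right_mono) auto
    moreover have "0 \<le> ?k * ?y" "0 \<le> ?l * ?z" "0 \<le> ?l * ?w" using logs by auto
    ultimately show ?thesis by (simp add: algebra_simps)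
  qed
  ultimately have "exp (- (\<epsilon> * a * ?u)\<^sup>2 / (2 * (4 * ?k * ?l)))
      \<le> exp (- ?x) * ((exp (- (?k * ?x)) * exp (- (?k * ?y))) * (exp (- (?l * ?z)) * exp (- (?l * ?w))))"
    by (simp flip: exp_add)
  also have "\<dots> = 1 / n * weight (1 / n) (1 / (real N - n)) (1 / m) (1 / (real M - m)) A B"
  proof -
    have "exp (- (real j * ln s)) = (1 / s) ^ j" if "0 < s" for j and s :: real
      using that by (simp add: exp_minus exp_of_nat_mult power_one_over inverse_eq_divide)
    then show ?thesis
      using nn by (simp add: weight_def card_swapped[OF comp] exp_minus inverse_eq_divide)
  qed
  finally show ?thesis .
qed

text \<open>Each of the four factors of the weight contributes at most \<open>exp 1\<close> to the sum over all competitors.\<close>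

lemma prob_high_interaction: "prob_noise high_interaction \<le> exp 4 / n"
proof -
  let ?wt = "weight (1 / n) (1 / (real N - n)) (1 / m) (1 / (real M - m))"
  have sub: "near \<subseteq> competitors" by (auto simp: near_def)
  have "prob_noise (\<lambda>\<xi>. \<exists>s\<in>near. (case s of (A, B) \<Rightarrow> \<epsilon> * a * (rows_missed A * m + n * cols_missed B))
        \<le> (\<Sum>x\<in>grid N M. (case s of (A, B) \<Rightarrow> interaction A B) x * \<xi> x))
      \<le> (\<Sum>s\<in>near. exp (- (case s of (A, B) \<Rightarrow> \<epsilon> * a * (rows_missed A * m + n * cols_missed B))\<^sup>2
        / (2 * (case s of (A, B) \<Rightarrow> 4 * rows_missed A * cols_missed B))))"
    unfolding noise_law_def using a \<epsilon>_bounds sub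
    by (intro gaussian_union_bound finite_grid finite_families) (auto simp: interaction_variance)
  also have "\<dots> \<le> (\<Sum>(A, B)\<in>near. 1 / n * ?wt A B)"
    by (rule sum_mono) (use near_exponent in force)
  also have "\<dots> = 1 / n * (\<Sum>(A, B)\<in>near. ?wt A B)"
    by (simp add: sum_distrib_left case_prod_unfold)
  also have "\<dots> \<le> 1 / n * exp (n * (1 / n) + (real N - n) * (1 / (real N - n)) + m * (1 / m) + (real M - m) * (1 / (real M - m)))"
    using n m sub by (intro mult_left_mono sum_weight_le) auto
  also have "\<dots> = exp 4 / n"
    using n m by simp
  finally show ?thesis
    unfolding high_interaction_def by (simp add: case_prod_unfold)
qed

section \<open>Distant blocks rarely collect enough noise\<close>

text \<open>Sparsity makes \<open>n log (1/p) + m log (1/q)\<close> dominate any multiple of \<open>n + m\<close>, hence every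
factor that is exponential in \<open>n + m\<close>. The common factor \<open>n m\<close> avoids fractions.\<close>

lemma log_ratio_dominates_sides:
  assumes "\<delta> * (n * m) \<le> d"
  shows "3 * (n + m) * (real n * m) \<le> \<epsilon>\<^sup>2 * ((real n * ln (real N / n) + real m * ln (real M / m)) * d)"
proof -
  let ?H = "real n * ln (real N / n) + real m * ln (real M / m)"
  have "real n * (24 / \<epsilon> ^ 4) + real m * (24 / \<epsilon> ^ 4) \<le> ?H"
    using sparse unfolding \<epsilon>_def by (intro add_mono mult_left_mono) auto
  then have H: "(n + m) * (24 / \<epsilon> ^ 4) \<le> ?H" by (simp add: algebra_simps add_divide_distrib)
  have "\<epsilon>\<^sup>2 * (((n + m) * (24 / \<epsilon> ^ 4)) * (\<delta> * (n * m))) \<le> \<epsilon>\<^sup>2 * (?H * d)"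
  proof (intro mult_left_mono mult_mono H assms)
    have "0 \<le> (n + m) * (24 / \<epsilon> ^ 4)" by simp
    then show "0 \<le> ?H" using H by linarith
  qed (use \<delta>_bounds in auto)
  moreover have "\<epsilon>\<^sup>2 * (((n + m) * (24 / \<epsilon> ^ 4)) * (\<delta> * (n * m))) = 3 * (n + m) * (real n * m)"
    using \<epsilon>_bounds by (simp add: \<delta>_def field_simps power_def eval_nat_numeral)
  ultimately show ?thesis by simp
qed

text \<open>The condition \<open>total_signal\<close>, rescaled from the whole block to \<open>d\<close> missed entries.\<close>

lemma log_ratio_le_signal:
  assumes "\<delta> * (n * m) \<le> d"
  shows "b\<^sup>2 * ((real n * ln (real N / n) + real m * ln (real M / m)) * d) \<le> (a\<^sup>2 * d / 2) * (real n * m)"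
proof -
  have "0 \<le> \<delta> * (n * m)" using \<delta>_bounds by simp
  then have "0 \<le> d" using assms by linarith
  from mult_right_mono[OF total_signal this] show ?thesis by (simp add: algebra_simps)
qed

lemma far_low_exponent:
  assumes d: "\<delta> * (n * m) \<le> d"
  shows "3 * (n + m) \<le> \<epsilon>\<^sup>2 * (a\<^sup>2 * d / 2)"
proof -
  let ?Hd = "(real n * ln (real N / n) + real m * ln (real M / m)) * d"
  have "0 \<le> \<epsilon>\<^sup>2 * ?Hd" using log_ratio_dominates_sides[OF d] by (rule order_trans[rotated]) simp
  then have "1 * (\<epsilon>\<^sup>2 * ?Hd) \<le> b\<^sup>2 * (\<epsilon>\<^sup>2 * ?Hd)"
    using b by (intro mult_right_mono) (simp_all add: one_le_power)
  with log_ratio_dominates_sides[OF d] have "3 * (n + m) * (real n * m) \<le> \<epsilon>\<^sup>2 * (b\<^sup>2 * ?Hd)"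
    by (simp add: mult.left_commute)
  also have "\<dots> \<le> \<epsilon>\<^sup>2 * ((a\<^sup>2 * d / 2) * (real n * m))"
    by (intro mult_left_mono log_ratio_le_signal d) simp
  finally have "3 * (n + m) * (real n * m) \<le> \<epsilon>\<^sup>2 * (a\<^sup>2 * d / 2) * (real n * m)" by simp
  then show ?thesis using n m by (subst (asm) mult_le_cancel_right_pos) auto
qed

text \<open>Here \<open>d \<ge> k m\<close> and \<open>d \<ge> n l\<close> are what compares the signal, which is proportional to \<open>d\<close>, with the entropies of the
row set and of the column set. As \<open>(1 - \<epsilon>)\<^sup>2 b\<^sup>2 \<ge> 1 + \<epsilon>\<close>, a fraction \<open>\<epsilon>\<close> of the exponent remains to absorb \<open>3 (n + m)\<close>.\<close>

lemma far_high_exponent: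
  assumes AB: "(A, B) \<in> far"
  shows "rows_missed A * ln (real N / n) + cols_missed B * ln (real M / m) + 3 * (n + m)
    \<le> (1 - \<epsilon>)\<^sup>2 * (a\<^sup>2 * entries_missed A B / 2)"
proof -
  let ?d = "entries_missed A B" and ?k = "rows_missed A" and ?l = "cols_missed B"
  let ?p = "ln (real N / n)" and ?q = "ln (real M / m)"
  let ?Hd = "(real n * ?p + real m * ?q) * ?d"
  have d: "\<delta> * (n * m) \<le> ?d" using AB by (simp add: far_def)
  have "0 \<le> 24 / slack b ^ 4" by simp
  then have pq: "0 \<le> ?p" "0 \<le> ?q" using sparse by linarith+
  have "real n * ?p * (?k * m) + real m * ?q * (n * ?l) \<le> real n * ?p * ?d + real m * ?q * ?d"
    using pq by (intro add_mono mult_left_mono entries_missed_ge) auto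
  then have Hd: "(?k * ?p + ?l * ?q) * (real n * m) \<le> ?Hd"
    by (simp add: algebra_simps)
  moreover have "0 \<le> (?k * ?p + ?l * ?q) * (real n * m)" using pq by simp
  ultimately have Hd0: "0 \<le> ?Hd" by linarith
  have "\<epsilon>\<^sup>2 \<le> \<epsilon>" using \<epsilon>_bounds by (simp add: power2_eq_square mult_left_le)
  then have "\<epsilon>\<^sup>2 * ?Hd \<le> \<epsilon> * ?Hd" using Hd0 by (intro mult_right_mono)
  with Hd log_ratio_dominates_sides[OF d]
  have "(?k * ?p + ?l * ?q + 3 * (n + m)) * (real n * m) \<le> (1 + \<epsilon>) * ?Hd"
    by (simp add: algebra_simps)
  also have "\<dots> \<le> ((1 - \<epsilon>)\<^sup>2 * b\<^sup>2) * ?Hd"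
  proof (rule mult_right_mono[OF _ Hd0])
    have "(1 - \<epsilon>) * b = 1 + 3 * (\<epsilon> * b)" using b by (simp add: \<epsilon>_def slack_def field_simps)
    moreover have "\<epsilon> * 1 \<le> \<epsilon> * b" using b \<epsilon>_bounds by (intro mult_left_mono) auto
    ultimately have "1 + \<epsilon> \<le> (1 - \<epsilon>) * b" using \<epsilon>_bounds by linarith
    moreover have "1 + \<epsilon> \<le> (1 + \<epsilon>)\<^sup>2" using \<epsilon>_bounds by (simp add: power2_eq_square)
    ultimately show "1 + \<epsilon> \<le> (1 - \<epsilon>)\<^sup>2 * b\<^sup>2"
      using \<epsilon>_bounds power_mono[of "1 + \<epsilon>" "(1 - \<epsilon>) * b" 2] by (simp add: power_mult_distrib)
  qed
  also have "\<dots> \<le> (1 - \<epsilon>)\<^sup>2 * ((a\<^sup>2 * ?d / 2) * (real n * m))"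
    using mult_left_mono[OF log_ratio_le_signal[OF d], of "(1 - \<epsilon>)\<^sup>2"] by (simp add: mult.assoc)
  finally have "(?k * ?p + ?l * ?q + 3 * (n + m)) * (real n * m) \<le> (1 - \<epsilon>)\<^sup>2 * (a\<^sup>2 * ?d / 2) * (real n * m)"
    by (simp only: mult.assoc)
  then show ?thesis using n m by (subst (asm) mult_le_cancel_right_pos) auto
qed

lemma far_pos: "\<delta> * (n * m) \<le> d \<Longrightarrow> 0 < d"
  using \<delta>_bounds n m by (meson less_le_trans mult_pos_pos of_nat_0_less_iff pos2)

text \<open>The exponent \<open>3 (n + m)\<close> beats the number of row and column subsets of the true support, which is \<open>2\<close> to the power \<open>n + m\<close>.\<close>

lemma prob_low_far: "prob_noise low_far \<le> exp (- real (n + m))"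
proof -
  define D where "D s = A0 \<times> B0 - fst s \<times> snd s" for s :: "nat set \<times> nat set"
  have D: "D s \<subseteq> grid N M" for s using A0 B0 by (auto simp: D_def grid_def)
  have sub: "far_kept \<subseteq> Pow A0 \<times> Pow B0" by (auto simp: far_kept_def)
  \<comment> \<open>The crude \<open>2 \<le> exp 1\<close> puts the count on the scale of the exponent.\<close>
  have card_far: "real (card far_kept) \<le> exp (n + m)"
  proof -
    have "card far_kept \<le> 2 ^ (n + m)"
      using card_mono[OF _ sub] A0 B0 by (simp add: card_cartesian_product card_Pow power_add)
    then have "real (card far_kept) \<le> 2 ^ (n + m)" by (metis of_nat_le_iff of_nat_numeral of_nat_power)
    also have "\<dots> \<le> exp 1 ^ (n + m)" using exp_ge_add_one_self[of 1] by (intro power_mono) auto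
    finally show ?thesis by (simp flip: exp_of_nat_mult)
  qed
  have sq: "(\<Sum>x\<in>grid N M. (-1 * indicator (D s) x)\<^sup>2) \<le> real (card (D s))" for s
    using indicator_weights(1)[OF finite_grid D, of "-1" s] by simp
  have "prob_noise (\<lambda>\<xi>. \<exists>s\<in>far_kept. \<epsilon> * a * card (D s) \<le> (\<Sum>x\<in>grid N M. (-1 * indicator (D s) x) * \<xi> x))
      \<le> (\<Sum>s\<in>far_kept. exp (- (\<epsilon> * a * card (D s))\<^sup>2 / (2 * real (card (D s)))))"
    unfolding noise_law_def using a \<epsilon>_bounds
    by (intro gaussian_union_bound finite_grid finite_families sq) auto
  also have "\<dots> \<le> (\<Sum>s\<in>far_kept. exp (- (3 * real (n + m))))"
  proof (rule sum_mono)
    fix s assume "s \<in> far_kept"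
    then have far: "\<delta> * (n * m) \<le> card (D s)" by (auto simp: far_kept_def D_def)
    have "(\<epsilon> * a * card (D s))\<^sup>2 / (2 * real (card (D s))) = \<epsilon>\<^sup>2 * (a\<^sup>2 * card (D s) / 2)"
      using far_pos[OF far] by (simp add: power2_eq_square)
    then show "exp (- (\<epsilon> * a * card (D s))\<^sup>2 / (2 * real (card (D s)))) \<le> exp (- (3 * real (n + m)))"
      using far_low_exponent[OF far] by simp
  qed
  also have "\<dots> \<le> exp (n + m) * exp (- (3 * real (n + m)))"
    using card_far by (simp add: mult_right_mono)
  also have "\<dots> \<le> exp (- real (n + m))" by (simp flip: exp_add)
  finally show ?thesis
    unfolding low_far_def by (simp only: indicator_weights[OF finite_grid D]) (simp add: D_def case_prod_unfold)
qed

text \<open>The terms \<open>k log (1/p) + l log (1/q)\<close> of the exponent become the weight with \<open>g = p\<close> and \<open>g' = q\<close>. The sum of these weights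
is at most \<open>exp (2 (n + m))\<close>, since \<open>(1 + p)\<close> to the power \<open>N\<close> is at most \<open>exp n\<close>.\<close>

lemma prob_high_far: "prob_noise high_far \<le> exp (- real (n + m))"
proof -
  let ?wt = "weight 1 (n / real N) 1 (m / real M)"
  define D where "D s = fst s \<times> snd s - A0 \<times> B0" for s :: "nat set \<times> nat set"
  have sub: "far \<subseteq> competitors" by (auto simp: far_def)
  have D: "D s \<subseteq> grid N M" if "s \<in> far" for s
    using sub that by (cases s) (auto simp: D_def grid_def competitors_def)
  have cardD: "real (card (D s)) = entries_missed (fst s) (snd s)" if "s \<in> far" for s
    using card_gained_entries[of "fst s" "snd s"] sub that by (auto simp: D_def)
  have sq: "(\<Sum>x\<in>grid N M. (1 * indicator (D s) x)\<^sup>2) \<le> real (card (D s))" if "s \<in> far" for s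
    using indicator_weights(1)[OF finite_grid D[OF that], of 1] by simp
  have "prob_noise (\<lambda>\<xi>. \<exists>s\<in>far. (1 - \<epsilon>) * a * card (D s) \<le> (\<Sum>x\<in>grid N M. (1 * indicator (D s) x) * \<xi> x))
      \<le> (\<Sum>s\<in>far. exp (- ((1 - \<epsilon>) * a * card (D s))\<^sup>2 / (2 * real (card (D s)))))"
    unfolding noise_law_def using a \<epsilon>_bounds
    by (intro gaussian_union_bound finite_grid finite_families sq) auto
  also have "\<dots> \<le> (\<Sum>s\<in>far. exp (- (3 * real (n + m))) * ?wt (fst s) (snd s))"
  proof (rule sum_mono)
    fix s assume s: "s \<in> far"
    obtain A B where AB: "s = (A, B)" by (cases s)
    let ?d = "entries_missed A B" and ?k = "rows_missed A" and ?l = "cols_missed B"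
    have "(A, B) \<in> far" using s AB by simp
    note exponent = far_high_exponent[OF this]
    have d: "0 < ?d" using s AB by (auto simp: far_def intro: far_pos)
    have "((1 - \<epsilon>) * a * ?d)\<^sup>2 / (2 * ?d) = (1 - \<epsilon>)\<^sup>2 * (a\<^sup>2 * ?d / 2)"
      using d by (simp add: power2_eq_square)
    then have "exp (- ((1 - \<epsilon>) * a * ?d)\<^sup>2 / (2 * ?d))
        \<le> exp (- (?k * ln (real N / n) + ?l * ln (real M / m) + 3 * (n + m)))"
      using exponent by simp
    also have "\<dots> = exp (- (3 * real (n + m))) * (exp (- (?k * ln (real N / n))) * exp (- (?l * ln (real M / m))))"
      by (simp flip: exp_add)
    also have "\<dots> = exp (- (3 * real (n + m))) * ?wt A B"
    proof -
      have "exp (- (real j * ln (real y / x))) = (real x / y) ^ j" if "0 < x" "0 < y" for j x y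
        using that by (simp add: exp_minus exp_of_nat_mult power_divide)
      moreover have "(A, B) \<in> competitors" using s AB sub by blast
      ultimately show ?thesis
        using n m by (simp add: weight_def card_swapped)
    qed
    finally show "exp (- ((1 - \<epsilon>) * a * card (D s))\<^sup>2 / (2 * real (card (D s))))
        \<le> exp (- (3 * real (n + m))) * ?wt (fst s) (snd s)"
      unfolding cardD[OF s] by (simp only: AB fst_conv snd_conv)
  qed
  also have "\<dots> = exp (- (3 * real (n + m))) * (\<Sum>(A, B)\<in>far. ?wt A B)"
    by (simp add: sum_distrib_left case_prod_unfold)
  also have "\<dots> \<le> exp (- (3 * real (n + m))) * exp (n * 1 + (real N - n) * (n / real N) + m * 1 + (real M - m) * (m / real M))"
    using sum_weight_le[OF sub, of 1 "n / real N" 1 "m / real M"] by (intro mult_left_mono) auto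
  also have "\<dots> \<le> exp (- (3 * real (n + m))) * exp (n * 1 + n + m * 1 + m)"
  proof -
    have "(real y - x) * (x / real y) \<le> x" if "0 < y" for x y :: nat
      using that by (simp add: field_simps)
    from this[of N n] this[of M m] show ?thesis using n m by simp
  qed
  also have "\<dots> = exp (- real (n + m))" by (simp flip: exp_add)
  finally have *: "prob_noise (\<lambda>\<xi>. \<exists>s\<in>far. (1 - \<epsilon>) * a * card (D s) \<le> (\<Sum>x\<in>grid N M. (1 * indicator (D s) x) * \<xi> x))
      \<le> exp (- real (n + m))" .
  have lin: "(\<Sum>x\<in>grid N M. (1 * indicator (D s) x) * \<xi> x) = sum \<xi> (fst s \<times> snd s - A0 \<times> B0)"
    if "s \<in> far" for s and \<xi> :: "nat \<times> nat \<Rightarrow> real"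
    unfolding indicator_weights(2)[OF finite_grid D[OF that]] by (simp add: D_def)
  have "high_far = (\<lambda>\<xi>. \<exists>s\<in>far. (1 - \<epsilon>) * a * card (D s) \<le> (\<Sum>x\<in>grid N M. (1 * indicator (D s) x) * \<xi> x))"
    unfolding high_far_def case_prod_unfold
    by (intro ext bex_cong refl) (simp only: lin cardD)
  with * show ?thesis by simp
qed

section \<open>The risk at a fixed mean matrix\<close>

lemma sets_exceeds:
  assumes "finite J" "\<And>s. s \<in> J \<Longrightarrow> f s \<in> borel_measurable (noise_law N M)"
  shows "{\<xi> \<in> space (noise_law N M). \<exists>s\<in>J. (t s :: real) \<le> f s \<xi>} \<in> sets (noise_law N M)"
  using assms by (intro sets.sets_Collect_finite_Ex borel_measurable_le) auto

lemma measurable_linear_form: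
  assumes "D \<subseteq> grid N M"
  shows "(\<lambda>\<xi>. \<Sum>x\<in>D. w x * \<xi> x) \<in> borel_measurable (noise_law N M)"
proof (rule borel_measurable_sum)
  fix x assume "x \<in> D"
  then have "(\<lambda>\<xi>. \<xi> x) \<in> noise_law N M \<rightarrow>\<^sub>M std_normal"
    unfolding noise_law_def using assms by (intro measurable_component_singleton) auto
  then have [measurable]: "(\<lambda>\<xi>. \<xi> x) \<in> borel_measurable (noise_law N M)" by simp
  show "(\<lambda>\<xi>. w x * \<xi> x) \<in> borel_measurable (noise_law N M)" by measurable
qed

lemma measurable_block:
  assumes "D \<subseteq> grid N M"
  shows "(\<lambda>\<xi>. s * sum \<xi> D) \<in> borel_measurable (noise_law N M)"
  using measurable_linear_form[OF assms, of "\<lambda>_. s"] by (simp add: sum_distrib_left)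

lemma sets_bad_events:
  "{\<xi> \<in> space (noise_law N M). low_row \<xi>} \<in> sets (noise_law N M)"
  "{\<xi> \<in> space (noise_law N M). high_row \<xi>} \<in> sets (noise_law N M)"
  "{\<xi> \<in> space (noise_law N M). low_col \<xi>} \<in> sets (noise_law N M)"
  "{\<xi> \<in> space (noise_law N M). high_col \<xi>} \<in> sets (noise_law N M)"
  "{\<xi> \<in> space (noise_law N M). high_interaction \<xi>} \<in> sets (noise_law N M)"
  "{\<xi> \<in> space (noise_law N M). low_far \<xi>} \<in> sets (noise_law N M)"
  "{\<xi> \<in> space (noise_law N M). high_far \<xi>} \<in> sets (noise_law N M)"
proof -
  have rows: "{i} \<times> B0 \<subseteq> grid N M" if "i \<in> {1..N}" for i using row_block[OF that] by blast
  have cols: "A0 \<times> {j} \<subseteq> grid N M" if "j \<in> {1..M}" for j using col_block[OF that] by blast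
  have lost: "A0 \<times> B0 - D \<subseteq> grid N M" for D using A0 B0 by (auto simp: grid_def)
  have gained: "fst s \<times> snd s - D \<subseteq> grid N M" if "s \<in> far" for s D
    using that by (cases s) (auto simp: far_def competitors_def grid_def)
  show "{\<xi> \<in> space (noise_law N M). low_row \<xi>} \<in> sets (noise_law N M)"
    unfolding low_row_def using A0(1) by (intro sets_exceeds measurable_block rows) auto
  show "{\<xi> \<in> space (noise_law N M). high_row \<xi>} \<in> sets (noise_law N M)"
    unfolding high_row_def by (intro sets_exceeds measurable_block rows) auto
  show "{\<xi> \<in> space (noise_law N M). low_col \<xi>} \<in> sets (noise_law N M)"
    unfolding low_col_def using B0(1) by (intro sets_exceeds measurable_block cols) auto
  show "{\<xi> \<in> space (noise_law N M). high_col \<xi>} \<in> sets (noise_law N M)"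
    unfolding high_col_def by (intro sets_exceeds measurable_block cols) auto
  show "{\<xi> \<in> space (noise_law N M). high_interaction \<xi>} \<in> sets (noise_law N M)"
    unfolding high_interaction_def case_prod_unfold
    by (intro sets_exceeds measurable_linear_form finite_families order_refl)
  show "{\<xi> \<in> space (noise_law N M). low_far \<xi>} \<in> sets (noise_law N M)"
    unfolding low_far_def case_prod_unfold
    by (intro sets_exceeds measurable_block finite_families lost)
  have "(\<lambda>\<xi>. sum \<xi> (fst s \<times> snd s - A0 \<times> B0)) \<in> borel_measurable (noise_law N M)" if "s \<in> far" for s
    using measurable_block[OF gained[OF that], of 1] by simp
  then show "{\<xi> \<in> space (noise_law N M). high_far \<xi>} \<in> sets (noise_law N M)"
    unfolding high_far_def case_prod_unfold by (intro sets_exceeds finite_families)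
qed

lemma prob_bad_noise:
  shows "{\<xi> \<in> space (noise_law N M). bad_noise \<xi>} \<in> sets (noise_law N M)"
    and "prob_noise bad_noise \<le> noise_bound b n m"
proof -
  interpret noise: prob_space "noise_law N M"
    unfolding noise_law_def by (rule prob_space_PiM) (rule prob_space_std_normal)
  let ?E = "\<lambda>Q. {\<xi> \<in> space (noise_law N M). Q \<xi>}"
  let ?U = "?E low_row \<union> (?E high_row \<union> (?E low_col \<union> (?E high_col \<union> (?E high_interaction \<union> (?E low_far \<union> ?E high_far)))))"
  have U: "?E bad_noise = ?U" by (auto simp: bad_noise_def)
  show "?E bad_noise \<in> sets (noise_law N M)"
    unfolding U by (intro sets.Un sets_bad_events)
  have "noise.prob ?U \<le> prob_noise low_row + (prob_noise high_row + (prob_noise low_col + (prob_noise high_col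
      + (prob_noise high_interaction + (prob_noise low_far + prob_noise high_far)))))"
    by (intro order_trans[OF measure_Un_le] add_left_mono sets.Un sets_bad_events order_refl)
  also have "\<dots> \<le> noise_bound b n m"
    using prob_low_row prob_high_row prob_low_col prob_high_col prob_high_interaction prob_low_far prob_high_far
    unfolding noise_bound_def c_def[symmetric] by linarith
  finally show "prob_noise bad_noise \<le> noise_bound b n m" unfolding U .
qed

text \<open>The bad event and its bound do not involve the mean matrix, which enters only through its support.\<close>

lemma risk_at_mean_le:
  assumes S: "S \<in> grid N M \<rightarrow>\<^sub>E UNIV"
    and S_in: "\<And>x. x \<in> A0 \<times> B0 \<Longrightarrow> a \<le> S x"
    and S_out: "\<And>x. x \<in> grid N M \<Longrightarrow> x \<notin> A0 \<times> B0 \<Longrightarrow> S x = 0"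
  shows "measure (observation_law N M S)
      {Y \<in> space (observation_law N M S). max_selector N M n m Y \<noteq> matrix_support N M S} \<le> noise_bound b n m"
proof -
  interpret noise: prob_space "noise_law N M"
    unfolding noise_law_def by (rule prob_space_PiM) (rule prob_space_std_normal)
  \<comment> \<open>Positivity of \<open>a\<close> makes the support exactly the block on which the mean is at least \<open>a\<close>.\<close>
  have supp: "matrix_support N M S = A0 \<times> B0"
    using A0 B0 a S_in S_out unfolding matrix_support_def grid_def by (fastforce dest: S_in)
  let ?g = "\<lambda>\<xi>. \<lambda>x\<in>grid N M. S x + \<xi> x"
  let ?E = "{Y \<in> space (matrix_space N M). max_selector N M n m Y \<noteq> A0 \<times> B0}"
  have g: "?g \<in> noise_law N M \<rightarrow>\<^sub>M matrix_space N M"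
    unfolding matrix_space_def
  proof (rule measurable_restrict)
    fix x assume "x \<in> grid N M"
    then have "(\<lambda>\<xi>. 1 * sum \<xi> {x}) \<in> borel_measurable (noise_law N M)"
      by (intro measurable_block) auto
    then show "(\<lambda>\<xi>. S x + \<xi> x) \<in> borel_measurable (noise_law N M)" by simp
  qed
  have sel: "max_selector N M n m \<in> matrix_space N M \<rightarrow>\<^sub>M count_space (submatrices N M n m)"
    using selector_max_selector[of n N m M] n m by (simp add: selector_def)
  have "max_selector N M n m -` (submatrices N M n m - {A0 \<times> B0}) \<inter> space (matrix_space N M) \<in> sets (matrix_space N M)"
    by (rule measurable_sets[OF sel]) simp
  moreover have "?E = max_selector N M n m -` (submatrices N M n m - {A0 \<times> B0}) \<inter> space (matrix_space N M)"
    using measurable_space[OF sel] by auto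
  ultimately have E: "?E \<in> sets (matrix_space N M)" by simp
  have "measure (observation_law N M S) ?E = noise.prob (?g -` ?E \<inter> space (noise_law N M))"
    unfolding observation_law_def by (rule measure_distr[OF g E])
  also have "\<dots> \<le> prob_noise bad_noise"
    using max_selector_eq_support[OF S S_in S_out]
    by (intro noise.finite_measure_mono prob_bad_noise) auto
  also have "\<dots> \<le> noise_bound b n m" by (rule prob_bad_noise)
  finally show ?thesis by (simp add: supp observation_law_def)
qed

end

section \<open>Uniform risk bound and its limit\<close>

lemma strong_signalI:
  assumes b: "1 < b" "b \<le> bound_B N M n m a" and a: "0 < a"
    and n: "2 \<le> n" "2 * n \<le> N" and m: "2 \<le> m" "2 * m \<le> M"
    and sparse: "24 / slack b ^ 4 \<le> ln (real N / real n)" "24 / slack b ^ 4 \<le> ln (real M / real m)"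
    and A0: "A0 \<subseteq> {1..N}" "card A0 = n" and B0: "B0 \<subseteq> {1..M}" "card B0 = m"
  shows "strong_signal N M n m a b A0 B0"
proof -
  have bounds: "b \<le> bound_A1 N n m a" "b \<le> bound_A2 M n m a" "b \<le> bound_A N M n m a"
    using b by (auto simp: bound_B_def)
  have threshold: "b * (sqrt 2 * (sqrt (ln (real x)) + sqrt (ln (real y - real x)))) \<le> a * s"
    if "2 \<le> x" "2 * x \<le> y" and "b \<le> a * s / (sqrt 2 * (sqrt (ln (real x)) + sqrt (ln (real y - real x))))" for x y s
  proof -
    have "1 < real x" "1 < real y - real x" using that by linarith+
    then have "0 < sqrt 2 * (sqrt (ln (real x)) + sqrt (ln (real y - real x)))"
      by (intro mult_pos_pos add_pos_pos) auto
    then show ?thesis using that by (simp add: pos_le_divide_eq)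
  qed
  let ?H = "real n * ln (real N / real n) + real m * ln (real M / real m)"
  have "0 < slack b" using b by (simp add: slack_def)
  then have "0 < 24 / slack b ^ 4" by simp
  then have "0 < ln (real N / real n)" "0 < ln (real M / real m)" using sparse by linarith+
  then have H: "0 < ?H" using n m by (intro add_pos_pos mult_pos_pos) auto
  have "b \<le> a * sqrt (real n * real m) / sqrt (2 * ?H)"
    using bounds(3) by (simp add: bound_A_def Let_def)
  then have "b * sqrt (2 * ?H) \<le> a * sqrt (real n * real m)"
    using H by (simp add: pos_le_divide_eq)
  then have "(b * sqrt (2 * ?H))\<^sup>2 \<le> (a * sqrt (real n * real m))\<^sup>2"
    using b H by (intro power_mono) auto
  moreover have "(b * sqrt (2 * ?H))\<^sup>2 = 2 * b\<^sup>2 * ?H"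
    using H by (simp add: power_mult_distrib del: real_sqrt_mult)
  moreover have "(a * sqrt (real n * real m))\<^sup>2 = a\<^sup>2 * (real n * real m)"
    by (simp add: power_mult_distrib)
  ultimately have "2 * b\<^sup>2 * ?H \<le> a\<^sup>2 * (real n * real m)" by simp
  with bounds assms threshold[of n N "sqrt m"] threshold[of m M "sqrt n"] show ?thesis
    by unfold_locales (simp_all add: bound_A1_def bound_A2_def)
qed

text \<open>Nonnegativity needs a mean matrix, because the supremum of the empty set of reals is unspecified.\<close>

lemma max_risk_le:
  assumes b: "1 < b" "b \<le> bound_B N M n m a" and a: "0 < a"
    and n: "2 \<le> n" "2 * n \<le> N" and m: "2 \<le> m" "2 * m \<le> M"
    and sparse: "24 / slack b ^ 4 \<le> ln (real N / real n)" "24 / slack b ^ 4 \<le> ln (real M / real m)"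
  shows "0 \<le> max_risk N M n m a (max_selector N M n m)"
    and "max_risk N M n m a (max_selector N M n m) \<le> noise_bound b n m"
proof -
  let ?r = "\<lambda>S. measure (observation_law N M S)
    {Y \<in> space (observation_law N M S). max_selector N M n m Y \<noteq> matrix_support N M S}"
  have r: "?r S \<le> noise_bound b n m" if "S \<in> mean_class N M n m a" for S
  proof -
    from that obtain A0 B0 where supp: "A0 \<subseteq> {1..N}" "card A0 = n" "B0 \<subseteq> {1..M}" "card B0 = m"
      and S: "S \<in> grid N M \<rightarrow>\<^sub>E UNIV"
      and vals: "\<forall>x\<in>grid N M. (x \<notin> A0 \<times> B0 \<longrightarrow> S x = 0) \<and> (x \<in> A0 \<times> B0 \<longrightarrow> a \<le> S x)"
      unfolding mean_class_def submatrices_def by blast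
    interpret strong_signal N M n m a b A0 B0
      using assms supp by (intro strong_signalI)
    have "A0 \<times> B0 \<subseteq> grid N M" using supp by (auto simp: grid_def)
    then show ?thesis using vals by (intro risk_at_mean_le S) auto
  qed
  have "(\<lambda>x\<in>grid N M. if x \<in> {1..n} \<times> {1..m} then a else 0) \<in> mean_class N M n m a"
  proof -
    have "{1..n} \<times> {1..m} \<in> submatrices N M n m"
      unfolding submatrices_def mem_Collect_eq
      by (intro exI[of _ "{1..n}"] exI[of _ "{1..m}"]) (use n m in simp)
    then show ?thesis unfolding mean_class_def by (auto intro!: bexI[of _ "{1..n} \<times> {1..m}"])
  qed
  then obtain S0 where S0: "S0 \<in> mean_class N M n m a" by blast
  show "max_risk N M n m a (max_selector N M n m) \<le> noise_bound b n m"
    unfolding max_risk_def using S0 by (intro cSUP_least r) auto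
  have "?r S0 \<le> max_risk N M n m a (max_selector N M n m)"
    unfolding max_risk_def by (intro cSUP_upper S0 bdd_aboveI2[of _ _ "noise_bound b n m"] r)
  then show "0 \<le> max_risk N M n m a (max_selector N M n m)"
    by (rule order_trans[rotated]) simp
qed

lemma noise_bound_tendsto_0:
  assumes "1 < b" "filterlim n at_top F" "filterlim m at_top F"
  shows "((\<lambda>x. noise_bound b (n x) (m x)) \<longlongrightarrow> 0) F"
proof -
  have n: "filterlim (\<lambda>x. real (n x)) at_top F" and m: "filterlim (\<lambda>x. real (m x)) at_top F"
    using assms by (auto intro: filterlim_compose[OF filterlim_real_sequentially])
  have "1\<^sup>2 < ((1 + b) / 2)\<^sup>2" using assms(1) by (intro power_strict_mono) auto
  then have e: "1 - ((1 + b) / 2)\<^sup>2 < 0" by simp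
  have nm: "filterlim (\<lambda>x. real (n x + m x)) at_top F"
    unfolding of_nat_add by (rule filterlim_at_top_add_at_top[OF n m])
  have "((\<lambda>x. exp 4 / real (n x)) \<longlongrightarrow> 0) F"
    by (rule tendsto_divide_0[OF tendsto_const]) (rule filterlim_at_top_imp_at_infinity[OF n])
  moreover have "((\<lambda>x. exp (- real (n x + m x))) \<longlongrightarrow> 0) F"
    using nm by (intro filterlim_compose[OF exp_at_bot]) (simp only: filterlim_uminus_at_top)
  ultimately have "((\<lambda>x. noise_bound b (n x) (m x)) \<longlongrightarrow> 2 * 0 + 2 * 0 + 0 + 2 * 0) F"
    unfolding noise_bound_def
    by (intro tendsto_intros tendsto_neg_powr[OF e n] tendsto_neg_powr[OF e m])
  then show ?thesis by simp
qed

lemma eventually_sparse: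
  fixes f len :: "'x \<Rightarrow> nat"
  assumes s: "filterlim f at_top F" and ratio: "((\<lambda>x. real (f x) / real (len x)) \<longlongrightarrow> 0) F"
    and len: "filterlim len at_top F"
  shows "eventually (\<lambda>x. 2 \<le> f x \<and> 2 * f x \<le> len x \<and> K \<le> ln (real (len x) / real (f x))) F"
proof -
  have "eventually (\<lambda>x. real (f x) / real (len x) < min (1 / 2) (exp (- K))) F"
    using ratio by (rule order_tendstoD) simp
  moreover have "eventually (\<lambda>x. 2 \<le> f x) F" "eventually (\<lambda>x. 1 \<le> len x) F"
    using s len by (auto simp: filterlim_at_top)
  ultimately show ?thesis
  proof eventually_elim
    case (elim x)
    then have pos: "0 < real (f x)" "0 < real (len x)" by auto
    have "real (f x) \<le> 1 / 2 * real (len x)" "real (f x) \<le> exp (- K) * real (len x)"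
      using elim(1) pos by (auto simp: pos_divide_less_eq intro: less_imp_le)
    then have "2 * f x \<le> len x" "exp K \<le> real (len x) / real (f x)"
      using pos by (simp_all add: exp_minus field_simps)
    then show ?case using elim pos by (simp add: ln_ge_iff)
  qed
qed

theorem theorem2p1:
  fixes n m :: "nat \<Rightarrow> nat \<Rightarrow> nat" and a :: "nat \<Rightarrow> nat \<Rightarrow> real"
  defines "F \<equiv> sequentially \<times>\<^sub>F sequentially"
  assumes "filterlim (\<lambda>(N, M). n N M) at_top F"
    and "filterlim (\<lambda>(N, M). m N M) at_top F"
    and "((\<lambda>(N, M). real (n N M) / real N) \<longlongrightarrow> 0) F"
    and "((\<lambda>(N, M). real (m N M) / real M) \<longlongrightarrow> 0) F"
    and "\<And>N M. a N M > 0"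
    and "Liminf F (\<lambda>(N, M). ereal (bound_B N M (n N M) (m N M) (a N M))) > 1"
  shows "((\<lambda>(N, M). max_risk N M (n N M) (m N M) (a N M)
            (max_selector N M (n N M) (m N M))) \<longlongrightarrow> 0) F"
proof -
  let ?n = "\<lambda>x. n (fst x) (snd x)" and ?m = "\<lambda>x. m (fst x) (snd x)"
  let ?R = "\<lambda>(N, M). max_risk N M (n N M) (m N M) (a N M) (max_selector N M (n N M) (m N M))"
  have n: "filterlim ?n at_top F" and m: "filterlim ?m at_top F"
    using assms(2,3) by (simp_all add: case_prod_unfold)
  have dims: "filterlim fst at_top F" "filterlim snd at_top F"
    unfolding F_def by (rule filterlim_fst filterlim_snd)+
  from assms(7) obtain b' where "1 < b'"
    and "b' < Liminf F (\<lambda>(N, M). ereal (bound_B N M (n N M) (m N M) (a N M)))"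
    using dense by blast
  moreover from this obtain b where b: "b' = ereal b" by (cases b') auto
  ultimately have b1: "1 < b"
    and B: "eventually (\<lambda>(N, M). b < bound_B N M (n N M) (m N M) (a N M)) F"
    by (auto simp: case_prod_unfold dest!: less_LiminfD)
  let ?K = "24 / slack b ^ 4"
  have "eventually (\<lambda>x. 2 \<le> ?n x \<and> 2 * ?n x \<le> fst x \<and> ?K \<le> ln (real (fst x) / real (?n x))) F"
    "eventually (\<lambda>x. 2 \<le> ?m x \<and> 2 * ?m x \<le> snd x \<and> ?K \<le> ln (real (snd x) / real (?m x))) F"
    using assms(4,5) by (intro eventually_sparse n m dims; simp add: case_prod_unfold)+
  with B have "eventually (\<lambda>x. 0 \<le> ?R x \<and> ?R x \<le> noise_bound b (?n x) (?m x)) F"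
  proof eventually_elim
    case (elim x)
    obtain N M where x: "x = (N, M)" by (cases x)
    show ?case
      using max_risk_le[OF b1 _ assms(6), of N M "n N M" "m N M" N M] elim by (simp add: x)
  qed
  then have "eventually (\<lambda>x. 0 \<le> ?R x) F" "eventually (\<lambda>x. ?R x \<le> noise_bound b (?n x) (?m x)) F"
    by (auto elim: eventually_mono)
  then show ?thesis
    by (rule tendsto_sandwich[OF _ _ tendsto_const noise_bound_tendsto_0[OF b1 n m]])
qed

end
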